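(* For every fixed integer $k\ge 2$, the decision problem CLSC-$k$ is $\exists\mathbb{R}$-hard.
   Context: Polynomials are given as explicit sums of monomials with integer coefficients written in binary; rational numbers are given as fractions of integers. The complexity class $\exists\mathbb{R}$ consists of all decision problems that are polynomial-time many-one reducible to the existential theory of the reals, i.e. the set of true sentences $\exists x_1\dots\exists x_n\,\Phi(x_1,\dots,x_n)$ where $\Phi$ is a quantifier-free Boolean combination of polynomial equations and inequalities with integer coefficients. A problem is $\exists\mathbb{R}$-hard if the existential theory of the reals (equivalently, the problem FEAS: given $r\in\mathbb{Z}[y_1,\dots,y_m]$, does $r$ have a real zero?) polynomial-time many-one reduces to it. CLSC-$k$ (Continuous Level-Set Component Counting): Instance: a polynomial $f\in\mathbb{Z}[x_1,\dots,x_d]$ and a rational threshold $\theta>0$. Question: does the super-level set $L_\theta=\{x\in\mathbb{R}^d: f(x)\ge\theta\}$ have at least $k$ connected components? *)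

theory Defs
  imports "HOL-Analysis.Analysis" "HOL-Computational_Algebra.Polynomial"
begin

section \<open>Deterministic multi-tape Turing machines\<close>

text \<open>
  Tapes are two-way infinite: a content function and a head position. Symbol 0 is the blank.
  A machine with \<open>states M = n\<close> has the working states \<open>0, \<dots>, n - 1\<close>; state 0 is initial
  and \<open>n\<close> is the halting state. \<open>delta M q ss\<close> maps the symbols \<open>ss\<close> under the heads to the next
  state and, for every tape, the symbol to write and the displacement of the head. Only its values
  on working states and on symbols of the finite alphabet \<open>{..<alphabet M}\<close> matter, so it is
  a finite table.
\<close>

type_synonym tape = "(int \<Rightarrow> nat) \<times> int"

type_synonym config = "nat \<times> tape list"

record turing_machine =
  tapes :: nat
  alphabet :: nat
  states :: nat
  delta :: "nat \<Rightarrow> nat list \<Rightarrow> nat \<times> (nat \<times> int) list"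

definition wf_turing_machine :: "turing_machine \<Rightarrow> bool" where
  "wf_turing_machine M \<longleftrightarrow>
     tapes M \<ge> 2 \<and>
     (\<forall>q<states M. \<forall>ss. length ss = tapes M \<and> set ss \<subseteq> {..<alphabet M} \<longrightarrow>
        fst (delta M q ss) \<le> states M \<and>
        length (snd (delta M q ss)) = tapes M \<and>
        set (snd (delta M q ss)) \<subseteq> {..<alphabet M} \<times> {-1, 0, 1})"

definition read_tape :: "tape \<Rightarrow> nat" where
  "read_tape t = fst t (snd t)"

definition act_on_tape :: "nat \<times> int \<Rightarrow> tape \<Rightarrow> tape" where
  "act_on_tape a t = ((fst t)(snd t := fst a), snd t + snd a)"

definition tm_step :: "turing_machine \<Rightarrow> config \<Rightarrow> config" where
  "tm_step M c =
     (if fst c < states M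
      then let r = delta M (fst c) (map read_tape (snd c))
           in (fst r, map2 act_on_tape (snd r) (snd c))
      else c)"

definition word_on_tape :: "nat list \<Rightarrow> int \<Rightarrow> nat" where
  "word_on_tape w i = (if 0 \<le> i \<and> i < int (length w) then w ! nat i else 0)"

definition tm_init :: "turing_machine \<Rightarrow> nat list \<Rightarrow> config" where
  "tm_init M w = (0, (word_on_tape w, 0) # replicate (tapes M - 1) (\<lambda>_. 0, 0))"

text \<open>
  Started on input \<open>w\<close> (on tape 0), \<open>M\<close> halts within \<open>t\<close> steps with output \<open>v\<close> on tape 1.
  Halting configurations are fixed points of \<^const>\<open>tm_step\<close>, so running exactly \<open>t\<close> steps suffices.
\<close>

definition tm_outputs_within :: "turing_machine \<Rightarrow> nat list \<Rightarrow> nat list \<Rightarrow> nat \<Rightarrow> bool" where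
  "tm_outputs_within M w v t \<longleftrightarrow>
     (let c = (tm_step M ^^ t) (tm_init M w)
      in fst c = states M \<and> fst (snd c ! 1) = word_on_tape v)"


section \<open>Decision problems and polynomial-time many-one reductions\<close>

text \<open>
  A decision problem consists of a set of instances, the subset of yes-instances, and an encoding
  of instances as words over a finite alphabet of nonzero (non-blank) symbols.
\<close>

record 'a problem =
  instances :: "'a set"
  yes :: "'a set"
  encode :: "'a \<Rightarrow> nat list"

definition poly_time_computable ::
  "('a \<Rightarrow> nat list) \<Rightarrow> ('b \<Rightarrow> nat list) \<Rightarrow> 'a set \<Rightarrow> ('a \<Rightarrow> 'b) \<Rightarrow> bool" where
  "poly_time_computable enc enc' X f \<longleftrightarrow>
     (\<exists>M (p :: nat poly). wf_turing_machine M \<and>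
        (\<forall>x\<in>X. set (enc x) \<subseteq> {0<..<alphabet M} \<and>
               tm_outputs_within M (enc x) (enc' (f x)) (poly p (length (enc x)))))"

definition poly_time_reducible :: "'a problem \<Rightarrow> 'b problem \<Rightarrow> bool" (infix \<open>\<le>\<^sub>p\<close> 50) where
  "A \<le>\<^sub>p B \<longleftrightarrow>
     (\<exists>f. (\<forall>x\<in>instances A. f x \<in> instances B \<and> (x \<in> yes A \<longleftrightarrow> f x \<in> yes B)) \<and>
          poly_time_computable (encode A) (encode B) (instances A) f)"


section \<open>Integer polynomials as explicit sums of monomials\<close>

text \<open>
  The pair \<open>(c, [e\<^sub>0, \<dots>, e\<^sub>d\<^sub>-\<^sub>1])\<close> is the monomial \<open>c * x\<^sub>0 ^ e\<^sub>0 * \<dots> * x\<^sub>d\<^sub>-\<^sub>1 ^ e\<^sub>d\<^sub>-\<^sub>1\<close>. The variables are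
  indexed from 0, as are the coordinates in \<^const>\<open>Euclidean_space\<close>. An exponent vector may
  occur several times in a sum.
\<close>

type_synonym monomial = "int \<times> nat list"

type_synonym int_mpoly = "monomial list"

definition mpoly_in :: "nat \<Rightarrow> int_mpoly \<Rightarrow> bool" where
  "mpoly_in d f \<longleftrightarrow> (\<forall>(c, es)\<in>set f. length es = d)"

definition eval_monomial :: "monomial \<Rightarrow> (nat \<Rightarrow> real) \<Rightarrow> real" where
  "eval_monomial m x = of_int (fst m) * (\<Prod>i<length (snd m). x i ^ (snd m ! i))"

definition eval_mpoly :: "int_mpoly \<Rightarrow> (nat \<Rightarrow> real) \<Rightarrow> real" where
  "eval_mpoly f x = (\<Sum>m\<leftarrow>f. eval_monomial m x)"


section \<open>Encoding by words\<close>

datatype sym =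
    Digit0 | Digit1 | PlusSym | MinusSym | CommaSym | SlashSym | VarSym
  | EqSym | GeSym | GtSym | NotSym | AndSym | OrSym

text \<open>The tape symbols representing the letters; 0 is reserved for the blank.\<close>

fun sym_code :: "sym \<Rightarrow> nat" where
  "sym_code Digit0 = 1"
| "sym_code Digit1 = 2"
| "sym_code PlusSym = 3"
| "sym_code MinusSym = 4"
| "sym_code CommaSym = 5"
| "sym_code SlashSym = 6"
| "sym_code VarSym = 7"
| "sym_code EqSym = 8"
| "sym_code GeSym = 9"
| "sym_code GtSym = 10"
| "sym_code NotSym = 11"
| "sym_code AndSym = 12"
| "sym_code OrSym = 13"

text \<open>Binary numerals, most significant bit first and without leading zeros; 0 is the empty word.\<close>

fun enc_nat :: "nat \<Rightarrow> sym list" where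
  "enc_nat n = (if n = 0 then [] else enc_nat (n div 2) @ [if even n then Digit0 else Digit1])"

declare enc_nat.simps [simp del]

definition enc_int :: "int \<Rightarrow> sym list" where
  "enc_int c = (if c < 0 then MinusSym else PlusSym) # enc_nat (nat \<bar>c\<bar>)"

text \<open>The leading sign of a coefficient also marks the beginning of a new monomial.\<close>

definition enc_monomial :: "monomial \<Rightarrow> sym list" where
  "enc_monomial m = enc_int (fst m) @ concat (map (\<lambda>e. CommaSym # enc_nat e) (snd m))"

definition enc_mpoly :: "int_mpoly \<Rightarrow> sym list" where
  "enc_mpoly f = concat (map enc_monomial f)"


section \<open>The existential theory of the reals\<close>

datatype qf_formula =
    EqZero int_mpoly
  | GeZero int_mpoly
  | GtZero int_mpoly
  | Neg qf_formula
  | Conj qf_formula qf_formula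
  | Disj qf_formula qf_formula

primrec holds :: "qf_formula \<Rightarrow> (nat \<Rightarrow> real) \<Rightarrow> bool" where
  "holds (EqZero p) x \<longleftrightarrow> eval_mpoly p x = 0"
| "holds (GeZero p) x \<longleftrightarrow> eval_mpoly p x \<ge> 0"
| "holds (GtZero p) x \<longleftrightarrow> eval_mpoly p x > 0"
| "holds (Neg \<phi>) x \<longleftrightarrow> \<not> holds \<phi> x"
| "holds (Conj \<phi> \<psi>) x \<longleftrightarrow> holds \<phi> x \<and> holds \<psi> x"
| "holds (Disj \<phi> \<psi>) x \<longleftrightarrow> holds \<phi> x \<or> holds \<psi> x"

primrec formula_in :: "nat \<Rightarrow> qf_formula \<Rightarrow> bool" where
  "formula_in n (EqZero p) \<longleftrightarrow> mpoly_in n p"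
| "formula_in n (GeZero p) \<longleftrightarrow> mpoly_in n p"
| "formula_in n (GtZero p) \<longleftrightarrow> mpoly_in n p"
| "formula_in n (Neg \<phi>) \<longleftrightarrow> formula_in n \<phi>"
| "formula_in n (Conj \<phi> \<psi>) \<longleftrightarrow> formula_in n \<phi> \<and> formula_in n \<psi>"
| "formula_in n (Disj \<phi> \<psi>) \<longleftrightarrow> formula_in n \<phi> \<and> formula_in n \<psi>"

text \<open>Formulas are written in Polish notation.\<close>

primrec enc_formula :: "qf_formula \<Rightarrow> sym list" where
  "enc_formula (EqZero p) = EqSym # enc_mpoly p"
| "enc_formula (GeZero p) = GeSym # enc_mpoly p"
| "enc_formula (GtZero p) = GtSym # enc_mpoly p"
| "enc_formula (Neg \<phi>) = NotSym # enc_formula \<phi>"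
| "enc_formula (Conj \<phi> \<psi>) = AndSym # enc_formula \<phi> @ enc_formula \<psi>"
| "enc_formula (Disj \<phi> \<psi>) = OrSym # enc_formula \<phi> @ enc_formula \<psi>"

text \<open>
  The instance \<open>(n, \<Phi>)\<close> is the sentence \<open>\<exists>x\<^sub>0 \<dots> \<exists>x\<^sub>n\<^sub>-\<^sub>1. \<Phi>\<close>. The quantifier prefix is written out, so that
  \<open>n\<close> is encoded in unary. Only the values of the assignment on \<open>{..<n}\<close> are relevant.
\<close>

definition ETR :: "(nat \<times> qf_formula) problem" where
  "ETR = \<lparr>
     instances = {(n, \<Phi>). formula_in n \<Phi>},
     yes = {(n, \<Phi>). formula_in n \<Phi> \<and> (\<exists>x :: nat \<Rightarrow> real. holds \<Phi> x)},
     encode = (\<lambda>(n, \<Phi>). map sym_code (replicate n VarSym @ enc_formula \<Phi>)) \<rparr>"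

definition ER_hard :: "'a problem \<Rightarrow> bool" where
  "ER_hard P \<longleftrightarrow> ETR \<le>\<^sub>p P"


section \<open>Continuous level-set component counting\<close>

definition superlevel_set :: "nat \<Rightarrow> int_mpoly \<Rightarrow> real \<Rightarrow> (nat \<Rightarrow> real) set" where
  "superlevel_set d f \<theta> = {x \<in> topspace (Euclidean_space d). eval_mpoly f x \<ge> \<theta>}"

text \<open>
  Stated without \<open>k \<le> card \<dots>\<close>, because \<^const>\<open>card\<close> is 0 on infinite sets.
\<close>

definition at_least_components :: "nat \<Rightarrow> 'a topology \<Rightarrow> bool" where
  "at_least_components k X \<longleftrightarrow>
     (\<exists>C \<subseteq> connected_components_of X. finite C \<and> card C = k)"

text \<open>
  The instance \<open>(d, f, a, b)\<close> has the threshold \<open>a / b\<close>. As in \<^const>\<open>ETR\<close>, the list of variables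
  is written out.
\<close>

definition CLSC :: "nat \<Rightarrow> (nat \<times> int_mpoly \<times> int \<times> int) problem" where
  "CLSC k = \<lparr>
     instances = {(d, f, a, b). d \<ge> 1 \<and> mpoly_in d f \<and> b \<noteq> 0 \<and> real_of_int a / real_of_int b > 0},
     yes = {(d, f, a, b). d \<ge> 1 \<and> mpoly_in d f \<and> b \<noteq> 0 \<and> real_of_int a / real_of_int b > 0 \<and>
              at_least_components k
                (subtopology (Euclidean_space d)
                  (superlevel_set d f (real_of_int a / real_of_int b)))},
     encode = (\<lambda>(d, f, a, b). map sym_code
                (replicate d VarSym @ enc_mpoly f @ [SlashSym] @ enc_int a @ [SlashSym] @ enc_int b)) \<rparr>"

end

theory Submission
  imports Defs
begin

text \<open>
  Let \<open>w\<close> be the word that encodes a sentence and \<open>N\<close> its length. Every position \<open>0, \<dots>, N\<close> of \<open>w\<close> gets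
  a block of 12 real variables, and every letter imposes polynomial equations with constant
  coefficients on its own block, on the next one and on the block of one existentially quantified
  variable. Together they evaluate the sentence: a letter of a numeral updates an accumulator
  (\<open>2 a + b\<close> in a coefficient, \<open>a\<^sup>2 x\<^sup>b\<close> in an exponent of \<open>x\<close>), a comma or a sign updates the current
  monomial and the current sum, and the connectives, read from right to left, act on a stack of
  truth values that is coded as one real number in the Cantor set.

  Hence the sentence is true iff \<open>- \<Sum> e\<^sup>2\<close>, summed over all the equations \<open>e = 0\<close>, vanishes somewhere.
  With a further variable \<open>z\<close>, the set where
  \<open>1 - \<Sum> e\<^sup>2 - ((z - 1) \<dots> (z - k))\<^sup>2 \<ge> 1\<close> consists of \<open>k\<close> translates of the solution set in
  disjoint hyperplanes, so it is empty or has at least \<open>k\<close> components.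

  No arithmetic is needed to write this polynomial down. Its monomials come from a finite table, and
  the exponent vector of each is written during one pass over the input, on which two marks
  show the blocks that occur in it.
\<close>

section \<open>Turing machines for repeated passes over the input\<close>

text \<open>The machine format fixes state 0 as initial and the largest number as halting, so a
  numbering of the control states must send two prescribed states to the two ends.\<close>

lemma ex_enumeration_between:
  assumes "finite X" "a \<in> X" "b \<in> X" "a \<noteq> b"
  shows "\<exists>h. inj_on h X \<and> h ` X \<subseteq> {..card X - 1} \<and> h a = (0::nat) \<and> h b = card X - 1"
proof -
  let ?R = "X - {a, b}"
  obtain h where h: "bij_betw h ?R {0..<card ?R}"
    using ex_bij_betw_finite_nat[of ?R] assms(1) by blast
  have cR: "card X = card ?R + 2"
    using assms card_Diff_subset[of "{a, b}" X] card_mono[of X "{a, b}"] by simp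
  define g where "g s = (if s = a then 0 else if s = b then Suc (card ?R) else Suc (h s))" for s
  have g: "g a = 0" "g b = Suc (card ?R)" and g3: "\<And>s. s \<in> ?R \<Longrightarrow> g s = Suc (h s)"
    using assms(4) by (simp_all add: g_def)
  have gR: "g s \<in> {0<..card ?R}" if "s \<in> ?R" for s
  proof -
    have "h s \<in> {0..<card ?R}" using h that bij_betwE by blast
    then show ?thesis using g3[OF that] by simp
  qed
  have inj: "s = t" if "s \<in> ?R" "t \<in> ?R" "g s = g t" for s t
    using inj_onD[OF bij_betw_imp_inj_on[OF h] _ that(1,2)] that(3) g3[OF that(1)] g3[OF that(2)]
    by simp
  have "inj_on g X"
  proof (rule inj_onI)
    fix s t assume st: "s \<in> X" "t \<in> X" "g s = g t"
    have "s = a \<or> s = b \<or> s \<in> ?R" "t = a \<or> t = b \<or> t \<in> ?R" using st by blast+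
    then show "s = t" using gR[of s] gR[of t] inj[OF _ _ st(3)] g st(3) by (elim disjE) simp_all
  qed
  moreover have "g ` X \<subseteq> {..card X - 1}"
  proof
    fix y assume "y \<in> g ` X"
    then obtain s where "s \<in> X" "y = g s" by auto
    then have "s = a \<or> s = b \<or> s \<in> ?R" by blast
    then show "y \<in> {..card X - 1}" using gR[of s] g cR \<open>y = g s\<close> by (elim disjE) simp_all
  qed
  ultimately show ?thesis using g cR by (intro exI[of _ g]) simp
qed

text \<open>A finite-state transducer passing over its word from left to right: \<open>pre\<close>
  writes before a pass, \<open>on\<close> handles and rewrites one cell, \<open>fin\<close> acts
  behind the last cell. Cells stay nonzero, so blanks always delimit the word.\<close>

locale sweeper =
  fixes on :: "'q \<Rightarrow> nat \<Rightarrow> 'q \<times> nat \<times> nat list"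
    and fin :: "'q \<Rightarrow> 'q \<times> nat list"
    and pre :: "'q \<Rightarrow> nat list"
    and Q :: "'q set" and q0 halt :: 'q and al :: nat
  assumes finite_Q: "finite Q" and q0: "q0 \<in> Q" and halt: "halt \<in> Q" and q0_halt: "q0 \<noteq> halt"
    and on_closed: "\<lbrakk>q \<in> Q; 0 < c; c < al; on q c = (q', c', v)\<rbrakk> \<Longrightarrow>
          q' \<in> Q \<and> 0 < c' \<and> c' < al \<and> set v \<subseteq> {..<al}"
    and fin_closed: "\<lbrakk>q \<in> Q; fin q = (q', v)\<rbrakk> \<Longrightarrow> q' \<in> Q \<and> set v \<subseteq> {..<al}"
    and pre_closed: "q \<in> Q \<Longrightarrow> set (pre q) \<subseteq> {..<al}"
    and al_pos: "0 < al"
begin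

fun mealy :: "'q \<Rightarrow> nat list \<Rightarrow> 'q \<times> nat list \<times> nat list" where
  "mealy q [] = (q, [], [])"
| "mealy q (c # u) =
     (let (q1, c', v) = on q c; (q2, u', v') = mealy q1 u in (q2, c' # u', v @ v'))"

definition sweep :: "'q \<times> nat list \<times> nat list \<Rightarrow> 'q \<times> nat list \<times> nat list" where
  "sweep = (\<lambda>(q, u, v). if q = halt then (q, u, v)
     else let (q1, u', v1) = mealy q u; (q2, v2) = fin q1 in (q2, u', v @ pre q @ v1 @ v2))"

lemma mealy_closed:
  assumes "mealy q u = (q', u', v)" "q \<in> Q" "set u \<subseteq> {0<..<al}"
  shows "q' \<in> Q \<and> set u' \<subseteq> {0<..<al} \<and> length u' = length u"
  using assms
proof (induction u arbitrary: q q' u' v)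
  case (Cons c u)
  obtain q1 c1 v1 where 1: "on q c = (q1, c1, v1)" by (cases "on q c")
  obtain q2 u2 v2 where 2: "mealy q1 u = (q2, u2, v2)" by (cases "mealy q1 u")
  show ?case using on_closed[OF _ _ _ 1] Cons.IH[OF 2] Cons.prems 1 2 by auto
qed auto

text \<open>A common bound on the words written at once keeps the set of pending words, and with it
  the control, finite.\<close>

definition max_out :: nat where
  "max_out = (SOME L. (\<forall>q\<in>Q. length (pre q) \<le> L \<and> length (snd (fin q)) \<le> L \<and>
     (\<forall>c<al. length (snd (snd (on q c))) \<le> L)))"

lemma max_out:
  assumes "q \<in> Q"
  shows "length (pre q) \<le> max_out" "fin q = (q', v) \<Longrightarrow> length v \<le> max_out"
    "\<lbrakk>c < al; on q c = (q', c', v)\<rbrakk> \<Longrightarrow> length v \<le> max_out"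
proof -
  let ?A = "(\<lambda>q. length (pre q)) ` Q \<union> (\<lambda>q. length (snd (fin q))) ` Q \<union>
            (\<lambda>(q, c). length (snd (snd (on q c)))) ` (Q \<times> {..<al})"
  have finA: "finite ?A" using finite_Q by simp
  have le: "x \<le> Max ?A" if "x \<in> ?A" for x by (rule Max_ge[OF finA that])
  have "\<exists>L. \<forall>q\<in>Q. length (pre q) \<le> L \<and> length (snd (fin q)) \<le> L \<and>
     (\<forall>c<al. length (snd (snd (on q c))) \<le> L)"
  proof (intro exI[of _ "Max ?A"] ballI conjI allI impI)
    fix q c assume "q \<in> Q" "c < al"
    then show "length (snd (snd (on q c))) \<le> Max ?A"
      by (intro le UnI2 image_eqI[of _ _ "(q, c)"]) simp_all
  qed (intro le, simp)+
  note L = someI_ex[OF this, folded max_out_def, rule_format, OF assms]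
  show "length (pre q) \<le> max_out" using L by blast
  show "length v \<le> max_out" if "fin q = (q', v)" using L that by simp
  show "length v \<le> max_out" if "c < al" "on q c = (q', c', v)"
    using L[THEN conjunct2, THEN conjunct2, rule_format, OF that(1)] that(2) by simp
qed

text \<open>
  A state of the simulating machine is \<open>(pend, right, q)\<close>: a word that remains to be written,
  one symbol per step, on the output tape, and the direction of the current pass over tape 0.
\<close>

definition ctrl :: "(nat list \<times> bool \<times> 'q) set" where
  "ctrl = {v. set v \<subseteq> {..<al} \<and> length v \<le> max_out} \<times> UNIV \<times> Q"

lemma finite_ctrl: "finite ctrl"
  unfolding ctrl_def using finite_Q finite_lists_length_le[of "{..<al}" max_out] by auto

lemma in_ctrl [simp]: "q \<in> Q \<Longrightarrow> ([], r, q) \<in> ctrl"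
  by (simp add: ctrl_def)

definition num_ctrl :: nat where "num_ctrl = card ctrl - 1"

text \<open>The halting number belongs to a state with nothing pending, so the machine stops only
  after the last output word is complete.\<close>

definition num :: "nat list \<times> bool \<times> 'q \<Rightarrow> nat" where
  "num = (SOME h. inj_on h ctrl \<and> h ` ctrl \<subseteq> {..num_ctrl} \<and>
     h ([], False, q0) = 0 \<and> h ([], False, halt) = num_ctrl)"

lemma num:
  "inj_on num ctrl" "num ` ctrl \<subseteq> {..num_ctrl}"
  "num ([], False, q0) = 0" "num ([], False, halt) = num_ctrl"
proof -
  have "([], False, q0) \<noteq> ([] :: nat list, False, halt)" using q0_halt by simp
  from ex_enumeration_between[OF finite_ctrl in_ctrl[OF q0] in_ctrl[OF halt] this]
  have "\<exists>h. inj_on h ctrl \<and> h ` ctrl \<subseteq> {..num_ctrl} \<and>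
     h ([], False, q0) = 0 \<and> h ([], False, halt) = num_ctrl"
    unfolding num_ctrl_def .
  from someI_ex[OF this, folded num_def]
  show "inj_on num ctrl" "num ` ctrl \<subseteq> {..num_ctrl}" "num ([], False, q0) = 0" "num ([], False, halt) = num_ctrl" by auto
qed

lemma num_less:
  assumes "s \<in> ctrl" "s \<noteq> ([], False, halt)"
  shows "num s < num_ctrl"
proof -
  have "([], False, halt) \<in> ctrl" using halt by (auto simp: ctrl_def)
  then have "num s \<noteq> num_ctrl" using assms num(1,4) unfolding inj_on_def by metis
  then show ?thesis using num(2) assms(1) by force
qed

text \<open>While a word is pending, only the output head moves. A blank under the input head marks
  an end of the word: going right it triggers \<open>fin\<close> and the turn, going left it
  triggers \<open>pre\<close> and the next pass.\<close>

definition act :: "nat list \<times> bool \<times> 'q \<Rightarrow> nat list \<Rightarrow>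
    (nat list \<times> bool \<times> 'q) \<times> (nat \<times> int) list" where
  "act s ss = (case s of (pend, r, q) \<Rightarrow> (case pend of
       a # pend' \<Rightarrow> ((pend', r, q), [(ss ! 0, 0), (a, 1)])
     | [] \<Rightarrow>
       if r then
         if ss ! 0 = 0 then (case fin q of (q', v) \<Rightarrow> ((v, False, q'), [(ss ! 0, -1), (ss ! 1, 0)]))
         else (case on q (ss ! 0) of (q', c, v) \<Rightarrow> ((v, True, q'), [(c, 1), (ss ! 1, 0)]))
       else
         if ss ! 0 = 0 then ((pre q, True, q), [(ss ! 0, 1), (ss ! 1, 0)])
         else (([], False, q), [(ss ! 0, -1), (ss ! 1, 0)])))"

definition machine :: turing_machine where
  "machine = \<lparr> tapes = 2, alphabet = al, states = num_ctrl,
     delta = (\<lambda>k ss. case act (the_inv_into ctrl num k) ss of (s, as) \<Rightarrow> (num s, as)) \<rparr>"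

lemma act_closed:
  assumes "s \<in> ctrl" "length ss = 2" "set ss \<subseteq> {..<al}" "act s ss = (s', as)"
  shows "s' \<in> ctrl \<and> length as = 2 \<and> set as \<subseteq> {..<al} \<times> {-1, 0, 1}"
proof -
  obtain pend r q where s: "s = (pend, r, q)" by (cases s)
  have q: "q \<in> Q" using assms(1) s by (auto simp: ctrl_def)
  obtain x y where ss: "ss = [x, y]" using assms(2)
    by (auto simp: numeral_2_eq_2 length_Suc_conv)
  have xy: "x < al" "y < al" using ss assms(3) by auto
  show ?thesis
  proof (cases pend)
    case (Cons a pend')
    then show ?thesis using assms(1,4) s ss xy by (auto simp: act_def ctrl_def)
  next
    case Nil
    obtain q1 v1 where f: "fin q = (q1, v1)" by (cases "fin q")
    obtain q2 c v2 where o: "on q x = (q2, c, v2)" by (cases "on q x")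
    consider (1) "x = 0" "r" | (2) "x \<noteq> 0" "r" | (3) "\<not> r" by blast
    then show ?thesis
    proof cases
      case 1
      then have "s' = (v1, False, q1)" "as = [(x, -1), (y, 0)]"
        using assms(4) s ss Nil f by (simp_all add: act_def)
      then show ?thesis using fin_closed[OF q f] max_out(2)[OF q f] xy by (simp add: ctrl_def)
    next
      case 2
      then have "s' = (v2, True, q2)" "as = [(c, 1), (y, 0)]"
        using assms(4) s ss Nil o by (simp_all add: act_def)
      then show ?thesis using on_closed[OF q _ xy(1) o] max_out(3)[OF q xy(1) o] xy 2
        by (simp add: ctrl_def)
    next
      case 3
      then show ?thesis
        using assms(4) s ss Nil pre_closed[OF q] max_out(1)[OF q] xy q
        by (auto simp: act_def ctrl_def split: if_splits)
    qed
  qed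
qed

lemma dec_num: "s \<in> ctrl \<Longrightarrow> the_inv_into ctrl num (num s) = s"
  using num(1) by (simp add: the_inv_into_f_f)

text \<open>Well-formedness quantifies over all numbers below \<open>num_ctrl\<close>, so each has
  to decode to a control state.\<close>

lemma surj_num: "k \<le> num_ctrl \<Longrightarrow> \<exists>s\<in>ctrl. num s = k"
proof -
  have "card (num ` ctrl) = card ctrl" using num(1) by (rule card_image)
  also have "\<dots> = card {..num_ctrl}"
    using finite_ctrl in_ctrl[OF q0]
    by (auto simp: num_ctrl_def card_gt_0_iff simp del: in_ctrl intro!: Suc_pred[symmetric])
  finally have "num ` ctrl = {..num_ctrl}" by (intro card_subset_eq num(2)) auto
  then show "k \<le> num_ctrl \<Longrightarrow> \<exists>s\<in>ctrl. num s = k" by (metis atMost_iff imageE)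
qed

lemma wf_machine: "wf_turing_machine machine"
proof -
  have "fst (delta machine k ss) \<le> num_ctrl \<and> length (snd (delta machine k ss)) = 2 \<and>
        set (snd (delta machine k ss)) \<subseteq> {..<al} \<times> {-1, 0, 1}"
    if "k < num_ctrl" "length ss = 2" "set ss \<subseteq> {..<al}" for k ss
  proof -
    obtain s where s: "s \<in> ctrl" "num s = k" using surj_num[of k] \<open>k < num_ctrl\<close> by auto
    obtain s' as where a: "act s ss = (s', as)" by (cases "act s ss")
    show ?thesis using act_closed[OF s(1) that(2,3) a] num(2) s a
      by (auto simp: machine_def dec_num)
  qed
  then show ?thesis by (auto simp: wf_turing_machine_def machine_def)
qed

section \<open>Simulation of passes by machine steps\<close>

definition conf :: "nat list \<times> bool \<times> 'q \<Rightarrow> nat list \<Rightarrow> int \<Rightarrow> nat list \<Rightarrow> config" where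
  "conf s u h v = (num s, [(word_on_tape u, h), (word_on_tape v, int (length v))])"

lemma word_on_tape_end [simp]: "word_on_tape v (int (length v)) = 0"
  by (simp add: word_on_tape_def)

lemma word_on_tape_snoc: "(word_on_tape v)(int (length v) := a) = word_on_tape (v @ [a])"
  by (auto simp: word_on_tape_def fun_eq_iff nth_append)

lemma word_on_tape_blank: "(word_on_tape v)(int (length v) := 0) = word_on_tape v"
  by (auto simp: word_on_tape_def)

text \<open>The output head rests on the blank behind the written word, hence the second symbol read
  is 0.\<close>

lemma tm_step_conf:
  assumes "s \<in> ctrl" "s \<noteq> ([], False, halt)"
    and "act s [word_on_tape u h, 0] = (s', [(c, dx), (a, dy)])"
  shows "tm_step machine (conf s u h v) =
    (num s', [((word_on_tape u)(h := c), h + dx),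
              ((word_on_tape v)(int (length v) := a), int (length v) + dy)])"
proof -
  have "num s < num_ctrl" using num_less[OF assms(1,2)] .
  moreover have "map read_tape (snd (conf s u h v)) = [word_on_tape u h, 0]"
    by (simp add: conf_def read_tape_def)
  moreover have "delta machine (num s) [word_on_tape u h, 0] = (num s', [(c, dx), (a, dy)])"
    unfolding machine_def turing_machine.select_convs dec_num[OF assms(1)] assms(3) by simp
  ultimately show ?thesis
    by (simp add: tm_step_def act_on_tape_def Let_def) (simp add: conf_def machine_def)
qed

lemma flush:
  assumes "(pend, r, q) \<in> ctrl"
  shows "(tm_step machine ^^ length pend) (conf (pend, r, q) u h v) = conf ([], r, q) u h (v @ pend)"
  using assms
proof (induction pend arbitrary: v)
  case (Cons a pend)
  have "tm_step machine (conf (a # pend, r, q) u h v) = conf (pend, r, q) u h (v @ [a])"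
    using Cons.prems
    by (subst tm_step_conf) (auto simp: act_def conf_def word_on_tape_snoc)
  moreover have "(pend, r, q) \<in> ctrl" using Cons.prems by (auto simp: ctrl_def)
  ultimately show ?case using Cons.IH by (simp add: funpow_swap1 del: funpow.simps add: funpow_Suc_right)
qed simp

lemma rewind:
  assumes "q \<in> Q" "q \<noteq> halt" "0 \<notin> set u" "j \<le> length u"
  shows "(tm_step machine ^^ j) (conf ([], False, q) u (int j - 1) v) = conf ([], False, q) u (-1) v"
  using assms(4)
proof (induction j)
  case (Suc j)
  have "u ! j \<noteq> 0" using Suc.prems assms(3) nth_mem[of j u] by (metis Suc_le_eq)
  then have "word_on_tape u (int j) \<noteq> 0" using Suc.prems by (simp add: word_on_tape_def)
  then have "tm_step machine (conf ([], False, q) u (int j) v) = conf ([], False, q) u (int j - 1) v"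
    using assms(1,2)
    by (subst tm_step_conf) (auto simp: act_def conf_def word_on_tape_blank)
  then show ?case using Suc by (simp add: funpow_swap1 del: funpow.simps add: funpow_Suc_right)
qed simp

text \<open>The prefix \<open>u0\<close> is a parameter because the tape behind the head already
  holds rewritten cells. Each cell costs one step plus at most \<open>max_out\<close> output
  steps.\<close>

lemma forward:
  assumes "mealy q u = (q', u', v')" "q \<in> Q" "set u \<subseteq> {0<..<al}"
  shows "\<exists>t \<le> Suc max_out * length u.
    (tm_step machine ^^ t) (conf ([], True, q) (u0 @ u) (int (length u0)) v) =
    conf ([], True, q') (u0 @ u') (int (length u0 + length u)) (v @ v')"
  using assms
proof (induction u arbitrary: q q' u' v' u0 v)
  case Nil
  then show ?case by (auto intro: exI[of _ 0])
next
  case (Cons c u)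
  obtain q1 c1 v1 where 1: "on q c = (q1, c1, v1)" by (cases "on q c")
  obtain q2 u2 v2 where 2: "mealy q1 u = (q2, u2, v2)" by (cases "mealy q1 u")
  have eq: "q' = q2" "u' = c1 # u2" "v' = v1 @ v2" using Cons.prems(1) 1 2 by auto
  have c: "0 < c" "c < al" using Cons.prems by auto
  have cl: "q1 \<in> Q" "set v1 \<subseteq> {..<al}" using on_closed[OF Cons.prems(2) c 1] by auto
  have v1: "length v1 \<le> max_out" using max_out(3)[OF Cons.prems(2) c(2) 1] .
  have "word_on_tape (u0 @ c # u) (int (length u0)) = c" by (simp add: word_on_tape_def)
  moreover have "(word_on_tape (u0 @ c # u))(int (length u0) := c1) = word_on_tape (u0 @ c1 # u)"
    by (auto simp: word_on_tape_def fun_eq_iff nth_append nth_Cons')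
  ultimately have "tm_step machine (conf ([], True, q) (u0 @ c # u) (int (length u0)) v) =
      conf (v1, True, q1) (u0 @ c1 # u) (int (length u0) + 1) v"
    using c 1 Cons.prems(2)
    by (subst tm_step_conf) (auto simp: act_def conf_def word_on_tape_blank)
  moreover have "(tm_step machine ^^ length v1)
      (conf (v1, True, q1) (u0 @ c1 # u) (int (length u0) + 1) v) =
      conf ([], True, q1) (u0 @ c1 # u) (int (length u0) + 1) (v @ v1)"
    by (rule flush) (use cl v1 in \<open>auto simp: ctrl_def\<close>)
  ultimately have A: "(tm_step machine ^^ Suc (length v1))
      (conf ([], True, q) (u0 @ c # u) (int (length u0)) v) =
      conf ([], True, q1) ((u0 @ [c1]) @ u) (int (length (u0 @ [c1]))) (v @ v1)"
    by (simp add: funpow_swap1 del: funpow.simps add: funpow_Suc_right add.commute)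
  obtain t where t: "t \<le> Suc max_out * length u"
    "(tm_step machine ^^ t) (conf ([], True, q1) ((u0 @ [c1]) @ u) (int (length (u0 @ [c1]))) (v @ v1))
      = conf ([], True, q2) ((u0 @ [c1]) @ u2) (int (length (u0 @ [c1]) + length u)) ((v @ v1) @ v2)"
    using Cons.IH[OF 2 cl(1), of "u0 @ [c1]" "v @ v1"] Cons.prems(3) by auto
  have "(tm_step machine ^^ (t + Suc (length v1)))
      (conf ([], True, q) (u0 @ c # u) (int (length u0)) v) =
      conf ([], True, q2) (u0 @ u') (int (length u0 + length (c # u))) (v @ v')"
    unfolding funpow_add comp_def A t(2) by (simp add: eq)
  moreover have "t + Suc (length v1) \<le> Suc max_out * length (c # u)" using t(1) v1 by simp
  ultimately show ?case using eq by blast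
qed

text \<open>Between passes the head stands on the last cell, where the turn at the right blank
  leaves it; so a pass begins with a rewind.\<close>

lemma simulate_sweep:
  assumes "sweep (q, u, v) = (q', u', v')" "q \<in> Q" "set u \<subseteq> {0<..<al}" "u \<noteq> []"
  shows "\<exists>t \<le> (max_out + 2) * (length u + 3).
     (tm_step machine ^^ t) (conf ([], False, q) u (int (length u) - 1) v) =
       conf ([], False, q') u' (int (length u') - 1) v'"
    and "q' \<in> Q" "set u' \<subseteq> {0<..<al}" "length u' = length u"
proof -
  obtain q1 u1 v1 where 1: "mealy q u = (q1, u1, v1)" by (cases "mealy q u")
  obtain q2 v2 where 2: "fin q1 = (q2, v2)" by (cases "fin q1")
  note cl = mealy_closed[OF 1 assms(2,3)]
  have f: "q2 \<in> Q" "set v2 \<subseteq> {..<al}" "length v2 \<le> max_out"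
    using fin_closed[OF _ 2] max_out(2)[OF _ 2] cl by auto
  show "q' \<in> Q" "set u' \<subseteq> {0<..<al}" "length u' = length u"
    using assms cl f 1 2 by (auto simp: sweep_def split: if_splits)
  show "\<exists>t \<le> (max_out + 2) * (length u + 3).
     (tm_step machine ^^ t) (conf ([], False, q) u (int (length u) - 1) v) =
       conf ([], False, q') u' (int (length u') - 1) v'"
  proof (cases "q = halt")
    case True
    then show ?thesis using assms(1) by (intro exI[of _ 0]) (auto simp: sweep_def)
  next
    case False
    have eq: "q' = q2" "u' = u1" "v' = v @ pre q @ v1 @ v2"
      using assms(1) False 1 2 by (auto simp: sweep_def)
    let ?s = "tm_step machine"
    have nz: "0 \<notin> set u" using assms(3) by auto
    have a: "(?s ^^ length u) (conf ([], False, q) u (int (length u) - 1) v) = conf ([], False, q) u (-1) v"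
      by (rule rewind) (use assms(2) False nz in auto)
    have b: "?s (conf ([], False, q) u (-1) v) = conf (pre q, True, q) u 0 v"
      using assms(2) False
      by (subst tm_step_conf) (auto simp: act_def conf_def word_on_tape_blank word_on_tape_def fun_eq_iff)
    have c: "(?s ^^ length (pre q)) (conf (pre q, True, q) u 0 v) = conf ([], True, q) u 0 (v @ pre q)"
      by (rule flush) (use assms(2) pre_closed max_out in \<open>auto simp: ctrl_def\<close>)
    obtain t where t: "t \<le> Suc max_out * length u"
      "(?s ^^ t) (conf ([], True, q) u 0 (v @ pre q)) = conf ([], True, q1) u1 (int (length u)) ((v @ pre q) @ v1)"
      using forward[OF 1 assms(2,3), of "[]" "v @ pre q"] by auto
    have d: "?s (conf ([], True, q1) u1 (int (length u)) (v @ pre q @ v1)) =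
        conf (v2, False, q2) u1 (int (length u) - 1) (v @ pre q @ v1)"
    proof -
      have "word_on_tape u1 (int (length u)) = 0" using cl by (simp add: word_on_tape_def)
      moreover have "(word_on_tape u1)(int (length u) := 0) = word_on_tape u1"
        using cl by (metis word_on_tape_blank)
      ultimately show ?thesis
        using cl 2 word_on_tape_blank[of "v @ pre q @ v1"]
        by (subst tm_step_conf) (auto simp: act_def conf_def)
    qed
    have e: "(?s ^^ length v2) (conf (v2, False, q2) u1 (int (length u) - 1) (v @ pre q @ v1)) =
        conf ([], False, q2) u1 (int (length u) - 1) ((v @ pre q @ v1) @ v2)"
      by (rule flush) (use f in \<open>auto simp: ctrl_def\<close>)
    have "(?s ^^ (length v2 + (Suc 0 + (t + (length (pre q) + (Suc 0 + length u))))))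
        (conf ([], False, q) u (int (length u) - 1) v) = conf ([], False, q') u' (int (length u') - 1) v'"
      unfolding funpow_add comp_def a using b c t(2) d e cl by (simp add: eq)
    moreover have "length v2 + (Suc 0 + (t + (length (pre q) + (Suc 0 + length u))))
        \<le> (max_out + 2) * (length u + 3)"
      using t(1) f(3) max_out(1)[OF assms(2)] by (simp add: algebra_simps)
    ultimately show ?thesis by blast
  qed
qed

lemma simulate_sweeps:
  assumes "(sweep ^^ n) (q, u, v) = (q', u', v')" "q \<in> Q" "set u \<subseteq> {0<..<al}" "u \<noteq> []"
  shows "\<exists>t \<le> n * ((max_out + 2) * (length u + 3)).
     (tm_step machine ^^ t) (conf ([], False, q) u (int (length u) - 1) v) =
       conf ([], False, q') u' (int (length u') - 1) v'"
  using assms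
proof (induction n arbitrary: q u v)
  case 0
  then show ?case by auto
next
  case (Suc n)
  obtain q1 u1 v1 where 1: "sweep (q, u, v) = (q1, u1, v1)" by (cases "sweep (q, u, v)")
  note s = simulate_sweep[OF 1 Suc.prems(2-4)]
  have "u1 \<noteq> []" using s(4) Suc.prems(4) by auto
  moreover have "(sweep ^^ n) (q1, u1, v1) = (q', u', v')"
    using Suc.prems(1) 1 by (simp add: funpow_swap1)
  ultimately obtain t where t: "t \<le> n * ((max_out + 2) * (length u + 3))"
     "(tm_step machine ^^ t) (conf ([], False, q1) u1 (int (length u1) - 1) v1) =
       conf ([], False, q') u' (int (length u') - 1) v'"
    using Suc.IH[of q1 u1 v1] s by auto
  obtain t1 where t1: "t1 \<le> (max_out + 2) * (length u + 3)"
     "(tm_step machine ^^ t1) (conf ([], False, q) u (int (length u) - 1) v) =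
       conf ([], False, q1) u1 (int (length u1) - 1) v1"
    using s(1) by blast
  have "(tm_step machine ^^ (t + t1)) (conf ([], False, q) u (int (length u) - 1) v) =
       conf ([], False, q') u' (int (length u') - 1) v'"
    unfolding funpow_add comp_def t1(2) t(2) ..
  moreover have "t + t1 \<le> Suc n * ((max_out + 2) * (length u + 3))" using t(1) t1(1) by simp
  ultimately show ?case by blast
qed

lemma tm_step_halted: "fst c = states M \<Longrightarrow> (tm_step M ^^ t) c = c"
  by (induction t) (auto simp: tm_step_def)

theorem machine_outputs:
  assumes "(sweep ^^ n) (q0, w, []) = (halt, u, v)" "set w \<subseteq> {0<..<al}" "w \<noteq> []"
    and "n \<le> n'"
  shows "tm_outputs_within machine w v (n' * ((max_out + 4) * (length w + 3)))"
proof -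
  let ?s = "tm_step machine" and ?B = "n' * ((max_out + 4) * (length w + 3))"
  have init: "tm_init machine w = conf ([], False, q0) w 0 []"
    by (auto simp: tm_init_def machine_def conf_def num(3) word_on_tape_def fun_eq_iff)
  have "q0 \<in> Q" "0 \<notin> set w" using q0 assms(2) by auto
  \<comment> \<open>One step is reserved for the initial move from cell 0 to the blank on its left;
    raising \<open>max_out + 2\<close> to \<open>max_out + 4\<close> pays for it.\<close>
  have le: "n * ((max_out + 2) * (length w + 3)) + 1 \<le> ?B"
  proof (cases n)
    case 0
    then show ?thesis using assms(1) q0_halt by simp
  next
    case (Suc m)
    have "n * ((max_out + 2) * (length w + 3)) + 1 \<le> n * ((max_out + 4) * (length w + 3))"
      using Suc by (simp add: algebra_simps)
    also have "\<dots> \<le> ?B" using assms(4) by (rule mult_right_mono) simp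
    finally show ?thesis .
  qed
  then obtain T where T: "?B = T + 1" by (metis add.commute le_add_diff_inverse add_leD2)
  obtain t where t: "t \<le> n * ((max_out + 2) * (length w + 3))"
    "(?s ^^ t) (conf ([], False, q0) w (int (length w) - 1) []) =
      conf ([], False, halt) u (int (length u) - 1) v"
    using simulate_sweeps[OF assms(1) q0 assms(2,3)] by blast
  have "t \<le> T" using t(1) le T by simp
  then obtain r where r: "T + length w = r + t" by (metis le_add_diff_inverse2 trans_le_add1)
  let ?h = "conf ([], False, halt) u (int (length u) - 1) v"
  have h: "(?s ^^ m) ?h = ?h" for m
    by (rule tm_step_halted) (simp add: conf_def num(4) machine_def)
  have one: "?s (conf ([], False, q0) w 0 []) = conf ([], False, q0) w (-1) []"
    using rewind[OF q0 q0_halt \<open>0 \<notin> set w\<close>, of 1 "[]"] assms(3) by (cases w) auto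
  \<comment> \<open>The head starts on the first cell rather than on the last one, but after rewinding this
    makes no difference.\<close>
  have "(?s ^^ ?B) (tm_init machine w) = (?s ^^ T) (conf ([], False, q0) w (-1) [])"
    unfolding T funpow_add comp_def init using one by simp
  also have "\<dots> = (?s ^^ (T + length w)) (conf ([], False, q0) w (int (length w) - 1) [])"
    unfolding funpow_add comp_def
    using rewind[OF q0 q0_halt \<open>0 \<notin> set w\<close>, of "length w" "[]"] by simp
  also have "\<dots> = ?h" unfolding r funpow_add comp_def t(2) h ..
  finally show ?thesis
    by (simp add: tm_outputs_within_def conf_def num(4) machine_def)
qed

end


section \<open>Local equations for the value of a sentence\<close>

datatype blk = Cur | Nxt | Ptr | Last

text \<open>
  The roles of the fields of a block: \<open>FX\<close> is an existentially quantified variable, \<open>FS\<close> the stack, \<open>FA\<close> the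
  sum of the completed monomials, \<open>FM\<close> the completed factors of the current one, \<open>FW\<close> the value of
  its last factor so far, and \<open>FG\<close> is 1 inside a coefficient and 0 inside an exponent. \<open>FU\<close>, \<open>FB\<close>, \<open>FC\<close>,
  \<open>FP\<close>, \<open>FQ\<close> are local witnesses, and \<open>FZ\<close> is used in the last block only, where it is the variable that
  separates the components.
\<close>

datatype fld = FX | FS | FA | FM | FW | FG | FU | FB | FC | FP | FQ | FZ

text \<open>Variables are named by role and field, not by position, so finitely many polynomials
  serve inputs of every length. Repeated variables encode powers.\<close>

type_synonym lpoly = "(int \<times> (blk \<times> fld) list) list"

definition ev_mon :: "(blk \<Rightarrow> fld \<Rightarrow> real) \<Rightarrow> int \<times> (blk \<times> fld) list \<Rightarrow> real" where
  "ev_mon \<rho> m = of_int (fst m) * (\<Prod>(b, l)\<leftarrow>snd m. \<rho> b l)"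

definition ev :: "(blk \<Rightarrow> fld \<Rightarrow> real) \<Rightarrow> lpoly \<Rightarrow> real" where
  "ev \<rho> p = (\<Sum>m\<leftarrow>p. ev_mon \<rho> m)"

definition var :: "blk \<Rightarrow> fld \<Rightarrow> lpoly" where "var b l = [(1, [(b, l)])]"
definition const :: "int \<Rightarrow> lpoly" where "const c = [(c, [])]"
definition lmul :: "lpoly \<Rightarrow> lpoly \<Rightarrow> lpoly" (infixl \<open>\<odot>\<close> 70) where
  "p \<odot> q = concat (map (\<lambda>m. map (\<lambda>m'. (fst m * fst m', snd m @ snd m')) q) p)"
definition ladd :: "lpoly \<Rightarrow> lpoly \<Rightarrow> lpoly" (infixl \<open>\<oplus>\<close> 65) where
  "p \<oplus> q = p @ q"
definition lsub :: "lpoly \<Rightarrow> lpoly \<Rightarrow> lpoly" (infixl \<open>\<ominus>\<close> 65) where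
  "p \<ominus> q = p @ (const (-1) \<odot> q)"

lemma ev_append: "ev \<rho> (p @ q) = ev \<rho> p + ev \<rho> q"
  by (simp add: ev_def)

lemma ev_simps [simp]:
  "ev \<rho> (var b l) = \<rho> b l"
  "ev \<rho> (const c) = of_int c"
  "ev \<rho> (p \<oplus> q) = ev \<rho> p + ev \<rho> q"
  "ev \<rho> (p \<odot> q) = ev \<rho> p * ev \<rho> q"
  "ev \<rho> (p \<ominus> q) = ev \<rho> p - ev \<rho> q"
proof -
  have mul: "ev \<rho> (p \<odot> q) = ev \<rho> p * ev \<rho> q" for p q
  proof (induction p)
    case (Cons m p)
    have "ev \<rho> (map (\<lambda>m'. (fst m * fst m', snd m @ snd m')) q) = ev_mon \<rho> m * ev \<rho> q"
      by (induction q) (auto simp: ev_def ev_mon_def algebra_simps)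
    then show ?case using Cons by (simp add: lmul_def ev_append algebra_simps ev_def[of _ "_ # _"] flip: ev_def)
  qed (simp add: lmul_def ev_def)
  have c: "ev \<rho> (const c) = of_int c" for c by (simp add: ev_def ev_mon_def const_def)
  show "ev \<rho> (var b l) = \<rho> b l" "ev \<rho> (const c) = of_int c" "ev \<rho> (p \<oplus> q) = ev \<rho> p + ev \<rho> q"
    by (simp_all add: ev_def ev_mon_def var_def const_def ladd_def)
  then show "ev \<rho> (p \<odot> q) = ev \<rho> p * ev \<rho> q" "ev \<rho> (p \<ominus> q) = ev \<rho> p - ev \<rho> q"
    by (simp_all add: mul lsub_def ev_append c)
qed

abbreviation "cur \<equiv> var Cur"
abbreviation "nxt \<equiv> var Nxt"

definition keep :: "fld list \<Rightarrow> lpoly list" where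
  "keep ls = map (\<lambda>l. nxt l \<ominus> cur l) ls"

definition flushed :: lpoly where
  "flushed = cur FA \<oplus> cur FM \<odot> cur FW"

definition is_bit :: "lpoly \<Rightarrow> lpoly" where
  "is_bit p = p \<odot> p \<ominus> p"

definition on_circle :: lpoly where
  "on_circle = cur FP \<odot> cur FP \<oplus> cur FQ \<odot> cur FQ \<ominus> const 1"

text \<open>The stack has ternary digits 0 and 2; pushing \<open>B\<close> on the older stack
  \<open>S'\<close> gives \<open>(S' + 2 B) / 3\<close>. Evaluation runs from right to left, so the
  older stack is that of the next block.\<close>

definition push_bit :: "lpoly" where
  "push_bit = const 3 \<odot> cur FS \<ominus> nxt FS \<ominus> const 2 \<odot> cur FB"

text \<open>The two leading ternary digits of the next stack: \<open>FB\<close> is the upper one,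
  from the first argument, and \<open>FC\<close> comes from the second.\<close>

definition pop_two :: "lpoly" where
  "pop_two = const 9 \<odot> nxt FS \<ominus> cur FP \<odot> cur FP \<ominus> const 2 \<odot> cur FC \<ominus> const 6 \<odot> cur FB"

text \<open>
  The sum of an atom starts with a guess \<open>- t\<close>, and the next letter that begins a formula requires
  the sum to be 0, so \<open>t\<close> is the value of the polynomial. \<open>FB\<close> is the truth value of \<open>t = 0\<close>, \<open>t \<ge> 0\<close> or
  \<open>t > 0\<close>, certified by \<open>FU\<close>. A connective at block \<open>i\<close> pops its arguments from the stack of block
  \<open>i + 1\<close>; the rest of the stack is \<open>FP\<^sup>2\<close>, kept in the unit interval by \<open>FP\<^sup>2 + FQ\<^sup>2 = 1\<close>.
\<close>

fun eqs :: "sym \<Rightarrow> lpoly list" where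
  "eqs Digit0 = keep [FS, FA, FM, FG] @
     [nxt FW \<ominus> (cur FG \<odot> (const 2 \<odot> cur FW) \<oplus> (const 1 \<ominus> cur FG) \<odot> (cur FW \<odot> cur FW))]"
| "eqs Digit1 = keep [FS, FA, FM, FG] @
     [nxt FW \<ominus> (cur FG \<odot> (const 2 \<odot> cur FW \<oplus> const 1) \<oplus>
        (const 1 \<ominus> cur FG) \<odot> (cur FW \<odot> cur FW \<odot> var Ptr FX))]"
| "eqs PlusSym = keep [FS] @ [nxt FA \<ominus> flushed, nxt FM \<ominus> const 1, nxt FW, nxt FG \<ominus> const 1]"
| "eqs MinusSym = keep [FS] @ [nxt FA \<ominus> flushed, nxt FM \<oplus> const 1, nxt FW, nxt FG \<ominus> const 1]"
| "eqs CommaSym = keep [FS, FA] @ [nxt FM \<ominus> cur FM \<odot> cur FW, nxt FW \<ominus> const 1, nxt FG]"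
| "eqs SlashSym = []"
| "eqs VarSym = keep [FS]"
| "eqs EqSym = [flushed, nxt FM, push_bit, is_bit (cur FB), cur FB \<odot> nxt FA,
     (const 1 \<ominus> cur FB) \<odot> (nxt FA \<odot> cur FU \<ominus> const 1)]"
| "eqs GeSym = [flushed, nxt FM, push_bit, is_bit (cur FB),
     cur FB \<odot> (nxt FA \<oplus> cur FU \<odot> cur FU),
     (const 1 \<ominus> cur FB) \<odot> (nxt FA \<odot> (cur FU \<odot> cur FU) \<ominus> const 1)]"
| "eqs GtSym = [flushed, nxt FM, push_bit, is_bit (cur FB),
     cur FB \<odot> (nxt FA \<odot> (cur FU \<odot> cur FU) \<oplus> const 1),
     (const 1 \<ominus> cur FB) \<odot> (nxt FA \<ominus> cur FU \<odot> cur FU)]"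
| "eqs NotSym = [flushed, nxt FM, nxt FA, is_bit (cur FB), on_circle,
     const 3 \<odot> nxt FS \<ominus> cur FP \<odot> cur FP \<ominus> const 2 \<odot> cur FB,
     const 3 \<odot> cur FS \<ominus> cur FP \<odot> cur FP \<ominus> const 2 \<odot> (const 1 \<ominus> cur FB)]"
| "eqs AndSym = [flushed, nxt FM, nxt FA, is_bit (cur FB), is_bit (cur FC), on_circle, pop_two,
     const 3 \<odot> cur FS \<ominus> cur FP \<odot> cur FP \<ominus> const 2 \<odot> (cur FB \<odot> cur FC)]"
| "eqs OrSym = [flushed, nxt FM, nxt FA, is_bit (cur FB), is_bit (cur FC), on_circle, pop_two,
     const 3 \<odot> cur FS \<ominus> cur FP \<odot> cur FP \<ominus>
       const 2 \<odot> (cur FB \<oplus> cur FC \<ominus> cur FB \<odot> cur FC)]"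

definition solves :: "(blk \<Rightarrow> fld \<Rightarrow> real) \<Rightarrow> lpoly list \<Rightarrow> bool" where
  "solves \<rho> E \<longleftrightarrow> (\<forall>e\<in>set E. ev \<rho> e = 0)"

type_synonym core = "real \<times> real \<times> real \<times> real \<times> real"

definition core_of :: "(fld \<Rightarrow> real) \<Rightarrow> core" where
  "core_of r = (r FS, r FA, r FM, r FW, r FG)"

text \<open>What \<open>eqs\<close> says about adjacent blocks once the witnesses are eliminated;
  \<open>solves_step\<close> and \<open>step_solves\<close> are the two directions. The guessed
  value of an atom is \<open>-A'\<close>.\<close>

fun step :: "sym \<Rightarrow> real \<Rightarrow> core \<Rightarrow> core \<Rightarrow> bool" where
  "step \<sigma> x (S, A, M, W, G) (S', A', M', W', G') \<longleftrightarrow> (case \<sigma> of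
     Digit0 \<Rightarrow> S' = S \<and> A' = A \<and> M' = M \<and> G' = G \<and> W' = G * (2 * W) + (1 - G) * W\<^sup>2
   | Digit1 \<Rightarrow> S' = S \<and> A' = A \<and> M' = M \<and> G' = G \<and> W' = G * (2 * W + 1) + (1 - G) * (W\<^sup>2 * x)
   | PlusSym \<Rightarrow> S' = S \<and> A' = A + M * W \<and> M' = 1 \<and> W' = 0 \<and> G' = 1
   | MinusSym \<Rightarrow> S' = S \<and> A' = A + M * W \<and> M' = -1 \<and> W' = 0 \<and> G' = 1
   | CommaSym \<Rightarrow> S' = S \<and> A' = A \<and> M' = M * W \<and> W' = 1 \<and> G' = 0
   | SlashSym \<Rightarrow> True
   | VarSym \<Rightarrow> S' = S
   | EqSym \<Rightarrow> A + M * W = 0 \<and> M' = 0 \<and> 3 * S = S' + 2 * of_bool (-A' = 0)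
   | GeSym \<Rightarrow> A + M * W = 0 \<and> M' = 0 \<and> 3 * S = S' + 2 * of_bool (-A' \<ge> 0)
   | GtSym \<Rightarrow> A + M * W = 0 \<and> M' = 0 \<and> 3 * S = S' + 2 * of_bool (-A' > 0)
   | NotSym \<Rightarrow> A + M * W = 0 \<and> M' = 0 \<and> A' = 0 \<and>
       (\<exists>b. \<exists>R\<in>{0..1}. 3 * S' = R + 2 * of_bool b \<and> 3 * S = R + 2 * of_bool (\<not> b))
   | AndSym \<Rightarrow> A + M * W = 0 \<and> M' = 0 \<and> A' = 0 \<and>
       (\<exists>b c. \<exists>R\<in>{0..1}. 9 * S' = R + 2 * of_bool c + 6 * of_bool b \<and>
          3 * S = R + 2 * of_bool (b \<and> c))
   | OrSym \<Rightarrow> A + M * W = 0 \<and> M' = 0 \<and> A' = 0 \<and>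
       (\<exists>b c. \<exists>R\<in>{0..1}. 9 * S' = R + 2 * of_bool c + 6 * of_bool b \<and>
          3 * S = R + 2 * of_bool (b \<or> c)))"

section \<open>Elimination of the local witnesses\<close>

lemmas eqs_simps = solves_def keep_def flushed_def is_bit_def on_circle_def push_bit_def pop_two_def

lemma bit_eq: "(b::real) * b - b = 0 \<longleftrightarrow> b = 0 \<or> b = 1"
  by algebra

lemma circle_unit: "p * p + q * q = 1 \<Longrightarrow> p * p \<in> {0..1::real}"
  by (metis atLeastAtMost_iff le_add_same_cancel1 zero_le_square)

declare split_paired_Ex [simp del] split_paired_All [simp del]

text \<open>Here \<open>a\<close> is minus the guessed value. Bit 0 forces \<open>a\<close> to be
  the inverse of a square, hence positive; bit 1 makes it minus a square.\<close>

lemma bit_ge: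
  fixes a b u :: real
  assumes "b * b - b = 0" "b * (a + u * u) = 0" "(1 - b) * (a * (u * u) - 1) = 0"
  shows "b = of_bool (-a \<ge> 0)"
proof -
  consider "b = 0" "a * (u * u) = 1" | "b = 1" "a = - (u * u)"
    using assms by (auto simp: bit_eq)
  then show ?thesis
  proof cases
    case 1
    then have "a > 0" by (smt (verit) mult_nonneg_nonneg mult_minus_left zero_le_square)
    then show ?thesis using 1 by simp
  qed simp
qed

lemma bit_gt:
  fixes a b u :: real
  assumes "b * b - b = 0" "b * (a * (u * u) + 1) = 0" "(1 - b) * (a - u * u) = 0"
  shows "b = of_bool (-a > 0)"
proof -
  consider "b = 0" "a = u * u" | "b = 1" "a * (u * u) = -1"
    using assms by (auto simp: bit_eq)
  then show ?thesis
  proof cases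
    case 2
    then have "a < 0" by (smt (verit) mult_nonneg_nonneg zero_le_square)
    then show ?thesis using 2 by simp
  next
    case 1
    then show ?thesis by (simp add: not_less)
  qed
qed

lemma solves_step:
  assumes "solves \<rho> (eqs \<sigma>)"
  shows "step \<sigma> (\<rho> Ptr FX) (core_of (\<rho> Cur)) (core_of (\<rho> Nxt))"
proof (cases \<sigma>)
  case EqSym
  then show ?thesis using assms by (auto simp: eqs_simps core_of_def bit_eq)
next
  case GeSym
  then have "\<rho> Cur FB = of_bool (- \<rho> Nxt FA \<ge> 0)"
    using assms by (intro bit_ge[of _ _ "\<rho> Cur FU"]) (auto simp: eqs_simps)
  then show ?thesis using assms GeSym by (simp add: eqs_simps core_of_def del: neg_0_le_iff_le)
next
  case GtSym
  then have "\<rho> Cur FB = of_bool (- \<rho> Nxt FA > 0)"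
    using assms by (intro bit_gt[of _ _ "\<rho> Cur FU"]) (auto simp: eqs_simps)
  then show ?thesis using assms GtSym by (simp add: eqs_simps core_of_def del: neg_0_less_iff_less)
next
  case NotSym
  obtain R where R: "\<rho> Cur FP * \<rho> Cur FP = R" "R \<in> {0..1}"
    using assms NotSym circle_unit[of "\<rho> Cur FP" "\<rho> Cur FQ"] by (auto simp: eqs_simps)
  have "\<rho> Cur FB = 0 \<or> \<rho> Cur FB = 1" using assms NotSym by (simp add: eqs_simps bit_eq)
  then have "3 * \<rho> Nxt FS = R + 2 * of_bool (\<rho> Cur FB = 1) \<and> 3 * \<rho> Cur FS = R + 2 * of_bool (\<rho> Cur FB \<noteq> 1)"
    using assms NotSym R(1) by (auto simp: eqs_simps)
  then show ?thesis using assms NotSym R(2) by (auto simp: eqs_simps core_of_def)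
next
  case AndSym
  obtain R where R: "\<rho> Cur FP * \<rho> Cur FP = R" "R \<in> {0..1}"
    using assms AndSym circle_unit[of "\<rho> Cur FP" "\<rho> Cur FQ"] by (auto simp: eqs_simps)
  have "\<rho> Cur FB = 0 \<or> \<rho> Cur FB = 1" "\<rho> Cur FC = 0 \<or> \<rho> Cur FC = 1"
    using assms AndSym by (simp_all add: eqs_simps bit_eq)
  then have "9 * \<rho> Nxt FS = R + 2 * of_bool (\<rho> Cur FC = 1) + 6 * of_bool (\<rho> Cur FB = 1) \<and>
      3 * \<rho> Cur FS = R + 2 * of_bool (\<rho> Cur FB = 1 \<and> \<rho> Cur FC = 1)"
    using assms AndSym R(1) by (auto simp: eqs_simps)
  then show ?thesis using assms AndSym R(2) by (simp add: eqs_simps core_of_def) blast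
next
  case OrSym
  obtain R where R: "\<rho> Cur FP * \<rho> Cur FP = R" "R \<in> {0..1}"
    using assms OrSym circle_unit[of "\<rho> Cur FP" "\<rho> Cur FQ"] by (auto simp: eqs_simps)
  have "\<rho> Cur FB = 0 \<or> \<rho> Cur FB = 1" "\<rho> Cur FC = 0 \<or> \<rho> Cur FC = 1"
    using assms OrSym by (simp_all add: eqs_simps bit_eq)
  then have "9 * \<rho> Nxt FS = R + 2 * of_bool (\<rho> Cur FC = 1) + 6 * of_bool (\<rho> Cur FB = 1) \<and>
      3 * \<rho> Cur FS = R + 2 * of_bool (\<rho> Cur FB = 1 \<or> \<rho> Cur FC = 1)"
    using assms OrSym R(1) by (auto simp: eqs_simps)
  then show ?thesis using assms OrSym R(2) by (simp add: eqs_simps core_of_def) blast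
qed (use assms in \<open>auto simp: eqs_simps core_of_def power2_eq_square\<close>)

text \<open>The witnesses are chosen before the valuation: they depend only on the two states and on
  \<open>x\<close>, so those of different blocks can later be combined into one assignment.\<close>

lemma step_solves:
  assumes "step \<sigma> x s s'"
  shows "\<exists>U B C P Q. \<forall>\<rho>. \<rho> Ptr FX = x \<and> core_of (\<rho> Cur) = s \<and> core_of (\<rho> Nxt) = s' \<and>
     \<rho> Cur FU = U \<and> \<rho> Cur FB = B \<and> \<rho> Cur FC = C \<and> \<rho> Cur FP = P \<and> \<rho> Cur FQ = Q
     \<longrightarrow> solves \<rho> (eqs \<sigma>)"
proof -
  obtain S A M W G where s: "s = (S, A, M, W, G)" by (cases s)
  obtain S' A' M' W' G' where s': "s' = (S', A', M', W', G')" by (cases s')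
  note d = s s' core_of_def eqs_simps
  have sqrt_circle: "sqrt R * sqrt R = R" "sqrt (1 - R) * sqrt (1 - R) = 1 - R" if "R \<in> {0..1}" for R
    using that by auto
  let ?ok = "\<lambda>U B C P Q. \<forall>\<rho>. \<rho> Ptr FX = x \<and> core_of (\<rho> Cur) = s \<and> core_of (\<rho> Nxt) = s' \<and>
     \<rho> Cur FU = U \<and> \<rho> Cur FB = B \<and> \<rho> Cur FC = C \<and> \<rho> Cur FP = P \<and> \<rho> Cur FQ = Q
     \<longrightarrow> solves \<rho> (eqs \<sigma>)"
  have "\<exists>U B C P Q. ?ok U B C P Q"
  proof (cases \<sigma>)
    case EqSym
    \<comment> \<open>For \<open>A' = 0\<close> the inverse is 0 by convention, and the equation
      that uses it is switched off by \<open>FB = 1\<close>.\<close>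
    have "?ok (inverse A') (of_bool (A' = 0)) 0 0 0"
      using assms by (auto simp: EqSym d)
    then show ?thesis by blast
  next
    case GeSym
    have "?ok (if A' \<le> 0 then sqrt (-A') else 1 / sqrt A') (of_bool (A' \<le> 0)) 0 0 0"
      using assms by (auto simp: GeSym d)
    then show ?thesis by blast
  next
    case GtSym
    have "?ok (if A' < 0 then 1 / sqrt (-A') else sqrt A') (of_bool (A' < 0)) 0 0 0"
      using assms by (auto simp: GtSym d)
    then show ?thesis by blast
  next
    case NotSym
    then obtain b R where R: "R \<in> {0..1}" "3 * S' = R + 2 * of_bool b" "3 * S = R + 2 * of_bool (\<not> b)"
      "A + M * W = 0" "M' = 0" "A' = 0"
      using assms by (auto simp: s s')
    have "?ok 0 (of_bool b) 0 (sqrt R) (sqrt (1 - R))"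
      using R(2-) sqrt_circle[OF R(1)] by (auto simp: NotSym d)
    then show ?thesis by blast
  next
    case AndSym
    then obtain b c R where R: "R \<in> {0..1}" "9 * S' = R + 2 * of_bool c + 6 * of_bool b"
       "3 * S = R + 2 * of_bool (b \<and> c)" "A + M * W = 0" "M' = 0" "A' = 0"
      using assms by (auto simp: s s')
    have "?ok 0 (of_bool b) (of_bool c) (sqrt R) (sqrt (1 - R))"
      using R(2-) sqrt_circle[OF R(1)] by (auto simp: AndSym d)
    then show ?thesis by blast
  next
    case OrSym
    then obtain b c R where R: "R \<in> {0..1}" "9 * S' = R + 2 * of_bool c + 6 * of_bool b"
       "3 * S = R + 2 * of_bool (b \<or> c)" "A + M * W = 0" "M' = 0" "A' = 0"
      using assms by (auto simp: s s')
    have "?ok 0 (of_bool b) (of_bool c) (sqrt R) (sqrt (1 - R))"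
      using R(2-) sqrt_circle[OF R(1)] by (auto simp: OrSym d)
    then show ?thesis by blast
  qed (use assms in \<open>auto simp: d power2_eq_square\<close>)
  then show ?thesis .
qed

text \<open>
  The pointer is 0 while a coefficient is read, so the variable \<open>x\<^sub>v\<close> is stored in block \<open>v + 1\<close>.
\<close>

fun next_ptr :: "sym \<Rightarrow> nat \<Rightarrow> nat" where
  "next_ptr PlusSym p = 0"
| "next_ptr MinusSym p = 0"
| "next_ptr CommaSym p = Suc p"
| "next_ptr \<sigma> p = p"

definition ptr :: "sym list \<Rightarrow> nat \<Rightarrow> nat" where
  "ptr w p = fold next_ptr w p"

text \<open>A relation, not a function: atoms guess a value and connectives guess truth
  values.\<close>

fun path :: "(nat \<Rightarrow> real) \<Rightarrow> nat \<Rightarrow> sym list \<Rightarrow> core \<Rightarrow> core \<Rightarrow> bool" where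
  "path xx p [] s s' \<longleftrightarrow> s' = s"
| "path xx p (\<sigma> # w) s s' \<longleftrightarrow> (\<exists>s1. step \<sigma> (xx p) s s1 \<and> path xx (next_ptr \<sigma> p) w s1 s')"

lemma path_append: "path xx p (u @ v) s s' \<longleftrightarrow> (\<exists>s1. path xx p u s s1 \<and> path xx (ptr u p) v s1 s')"
  by (induction u arbitrary: p s) (auto simp: ptr_def)

lemma ptr_simps [simp]: "ptr [] p = p" "ptr (\<sigma> # w) p = ptr w (next_ptr \<sigma> p)"
  "ptr (u @ v) p = ptr v (ptr u p)"
  by (auto simp: ptr_def)

section \<open>Values of numerals, monomials and polynomials along a path\<close>

lemma ptr_enc_nat [simp]: "ptr (enc_nat e) p = p"
  by (induction e rule: enc_nat.induct) (subst enc_nat.simps, auto)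

lemma path_coefficient:
  "path xx p (enc_nat e) (S, A, M, 0, 1) s' \<longleftrightarrow> s' = (S, A, M, real e, 1)"
proof (induction e arbitrary: s' rule: enc_nat.induct)
  case (1 e)
  show ?case
  proof (cases "e = 0")
    case True then show ?thesis by (simp add: enc_nat.simps)
  next
    case False
    have "real e = 2 * real (e div 2) + of_bool (odd e)"
      by (cases "even e") (auto elim!: evenE oddE)
    then show ?thesis using False 1[OF False]
      by (subst enc_nat.simps) (cases s', auto simp: path_append)
  qed
qed

text \<open>Repeated squaring: each digit squares the accumulator and a 1 also multiplies by the
  variable, so binary exponents need only equations of bounded degree.\<close>

lemma path_exponent:
  "path xx p (enc_nat e) (S, A, M, 1, 0) s' \<longleftrightarrow> s' = (S, A, M, xx p ^ e, 0)"
proof (induction e arbitrary: s' rule: enc_nat.induct)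
  case (1 e)
  show ?case
  proof (cases "e = 0")
    case True then show ?thesis by (simp add: enc_nat.simps)
  next
    case False
    have "xx p ^ e = (xx p ^ (e div 2))\<^sup>2 * (if even e then 1 else xx p)"
      by (auto elim!: evenE oddE simp: power_mult power2_eq_square power_add mult_2)
    then show ?thesis using False 1[OF False]
      by (subst enc_nat.simps) (cases s', auto simp: path_append)
  qed
qed

lemma step_functional [simp]:
  "step CommaSym x (S, A, M, W, G) s' \<longleftrightarrow> s' = (S, A, M * W, 1, 0)"
  "step PlusSym x (S, A, M, W, G) s' \<longleftrightarrow> s' = (S, A + M * W, 1, 0, 1)"
  "step MinusSym x (S, A, M, W, G) s' \<longleftrightarrow> s' = (S, A + M * W, -1, 0, 1)"
  by (cases s', auto)+

text \<open>Only the product \<open>M' * W'\<close> matters, since the last factor stays open until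
  a later letter closes it. A comma advances the pointer before its exponent is read, hence the
  index \<open>Suc p + i\<close>.\<close>

lemma path_exponents:
  "\<exists>M' W' G'. M' * W' = M * W * (\<Prod>i<length es. xx (Suc p + i) ^ (es ! i)) \<and>
     (\<forall>s'. path xx p (concat (map (\<lambda>e. CommaSym # enc_nat e) es)) (S, A, M, W, G) s' \<longleftrightarrow>
        s' = (S, A, M', W', G'))"
proof (induction es arbitrary: p M W G)
  case Nil
  show ?case by (intro exI[of _ M] exI[of _ W] exI[of _ G]) simp
next
  case (Cons e es)
  obtain M' W' G' where *: "M' * W' = M * W * xx (Suc p) ^ e * (\<Prod>i<length es. xx (Suc (Suc p) + i) ^ (es ! i))"
     "\<And>s'. path xx (Suc p) (concat (map (\<lambda>e. CommaSym # enc_nat e) es)) (S, A, M * W, xx (Suc p) ^ e, 0) s' \<longleftrightarrow>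
        s' = (S, A, M', W', G')"
    using Cons[of "M * W" "xx (Suc p) ^ e" "Suc p" 0] by blast
  have "path xx p (concat (map (\<lambda>e. CommaSym # enc_nat e) (e # es))) (S, A, M, W, G) s' \<longleftrightarrow>
        s' = (S, A, M', W', G')" for s'
    using *(2)[of s'] by (auto simp: path_append path_exponent)
  moreover have "M' * W' = M * W * (\<Prod>i<length (e # es). xx (Suc p + i) ^ ((e # es) ! i))"
    unfolding *(1) by (simp add: prod.lessThan_Suc_shift del: prod.lessThan_Suc)
  ultimately show ?case by blast
qed

text \<open>The sign closes the preceding monomial and resets the pointer. It becomes
  \<open>M\<close>, and reading the absolute value into \<open>W\<close> makes \<open>M * W\<close>
  the coefficient.\<close>

lemma path_monomial:
  fixes x :: "nat \<Rightarrow> real"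
  assumes "\<And>i. i < length es \<Longrightarrow> xx (Suc i) = x i"
  shows "\<exists>M' W' G'. M' * W' = eval_monomial (c, es) x \<and>
     (\<forall>s'. path xx p (enc_monomial (c, es)) (S, A, M, W, G) s' \<longleftrightarrow> s' = (S, A + M * W, M', W', G'))"
proof -
  let ?s = "if c < 0 then -1 else 1 :: real"
  have s: "?s * real (nat \<bar>c\<bar>) = of_int c" by auto
  obtain M' W' G' where *: "M' * W' = ?s * real (nat \<bar>c\<bar>) * (\<Prod>i<length es. xx (Suc 0 + i) ^ (es ! i))"
     "\<And>s'. path xx 0 (concat (map (\<lambda>e. CommaSym # enc_nat e) es)) (S, A + M * W, ?s, real (nat \<bar>c\<bar>), 1) s' \<longleftrightarrow>
        s' = (S, A + M * W, M', W', G')"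
    using path_exponents[where M = ?s and W = "real (nat \<bar>c\<bar>)" and es = es and xx = xx and p = 0 and S = S
        and A = "A + M * W" and G = 1] by blast
  have "M' * W' = eval_monomial (c, es) x"
    unfolding *(1) s using assms by (simp add: eval_monomial_def)
  moreover have "path xx p (enc_monomial (c, es)) (S, A, M, W, G) s' \<longleftrightarrow>
      s' = (S, A + M * W, M', W', G')" for s'
    unfolding *(2)[symmetric]
    by (auto simp: enc_monomial_def enc_int_def path_append path_coefficient)
  ultimately show ?thesis by blast
qed

text \<open>Each monomial adds its value to \<open>A + M * W\<close>. The end state is unique
  because no letter of a polynomial guesses.\<close>

lemma path_mpoly:
  assumes "mpoly_in n f" "\<And>i. i < n \<Longrightarrow> xx (Suc i) = x i"
  shows "\<exists>A' M' W' G'. A' + M' * W' = A + M * W + eval_mpoly f x \<and>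
     (\<forall>s'. path xx p (enc_mpoly f) (S, A, M, W, G) s' \<longleftrightarrow> s' = (S, A', M', W', G'))"
  using assms(1)
proof (induction f arbitrary: p A M W G)
  case Nil
  show ?case by (intro exI[of _ A] exI[of _ M] exI[of _ W] exI[of _ G])
      (simp add: eval_mpoly_def enc_mpoly_def)
next
  case (Cons m f)
  obtain c es where m: "m = (c, es)" by (cases m)
  have "length es = n" "mpoly_in n f" using Cons.prems m by (auto simp: mpoly_in_def)
  then obtain M1 W1 G1 where 1: "M1 * W1 = eval_monomial (c, es) x"
     "\<And>s'. path xx p (enc_monomial (c, es)) (S, A, M, W, G) s' \<longleftrightarrow> s' = (S, A + M * W, M1, W1, G1)"
    using path_monomial[where es = es and xx = xx and x = x and c = c and p = p and S = S and A = A
        and M = M and W = W and G = G] assms(2) by blast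
  obtain A' M' W' G' where 2: "A' + M' * W' = A + M * W + M1 * W1 + eval_mpoly f x"
     "\<And>s'. path xx (ptr (enc_monomial m) p) (enc_mpoly f) (S, A + M * W, M1, W1, G1) s' \<longleftrightarrow> s' = (S, A', M', W', G')"
    using Cons.IH[OF \<open>mpoly_in n f\<close>, of "A + M * W" M1 W1 "ptr (enc_monomial m) p" G1] by blast
  have "A' + M' * W' = A + M * W + eval_mpoly (m # f) x"
    using 1 2 m by (simp add: eval_mpoly_def)
  moreover have "path xx p (enc_mpoly (m # f)) (S, A, M, W, G) s' \<longleftrightarrow> s' = (S, A', M', W', G')" for s'
    using 1(2) 2(2) m by (simp add: enc_mpoly_def path_append)
  ultimately show ?case by blast
qed

text \<open>
  Cantor coding of the stack: \<open>S' \<in> [0, 1]\<close> is the coded rest, and the pushed bit is recovered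
  by comparing with 1/3 and 2/3.
\<close>

lemma pop_unique:
  assumes "R \<in> {0..1}" "R' \<in> {0..1::real}" "R + 2 * of_bool b = R' + 2 * of_bool b'"
  shows "R = R'" "b = b'"
  using assms by (auto simp: of_bool_def split: if_splits)

section \<open>Truth values of formulas along a path\<close>

definition residue :: "core \<Rightarrow> real" where
  "residue = (\<lambda>(S, A, M, W, G). A + M * W)"

text \<open>Every letter that starts a formula requires the sum before it to vanish; this checks the
  guess of the preceding atom.\<close>

lemma path_formula_residue: "path xx p (enc_formula \<phi>) s s' \<Longrightarrow> residue s = 0"
  by (cases \<phi>; cases s) (auto simp: residue_def)

text \<open>The sum starts at minus the guess, so a zero residue at the end identifies the guess
  with the value of the polynomial.\<close>

lemma path_atom_sound:
  assumes "mpoly_in n f" "\<And>i. i < n \<Longrightarrow> xx (Suc i) = x i"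
    and "\<sigma> \<in> {EqSym, GeSym, GtSym}"
    and "path xx p (\<sigma> # enc_mpoly f) s s'" "residue s' = 0"
  shows "3 * fst s = fst s' + 2 * of_bool (case \<sigma> of EqSym \<Rightarrow> eval_mpoly f x = 0
     | GeSym \<Rightarrow> eval_mpoly f x \<ge> 0 | _ \<Rightarrow> eval_mpoly f x > 0)"
proof -
  obtain S A M W G where s: "s = (S, A, M, W, G)" by (cases s)
  obtain S1 A1 M1 W1 G1 where st: "step \<sigma> (xx p) s (S1, A1, M1, W1, G1)"
    and pt: "path xx (next_ptr \<sigma> p) (enc_mpoly f) (S1, A1, M1, W1, G1) s'"
    using assms(4) by auto
  obtain A' M' W' G' where 1: "A' + M' * W' = A1 + M1 * W1 + eval_mpoly f x"
     "s' = (S1, A', M', W', G')"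
    using path_mpoly[OF assms(1), of xx x A1 M1 W1 "next_ptr \<sigma> p" S1 G1] assms(2) pt by blast
  have "M1 = 0" using st assms(3) by (auto simp: s)
  then have "- A1 = eval_mpoly f x" using 1 assms(5) by (simp add: residue_def)
  then show ?thesis using st assms(3) 1(2) by (auto simp: s simp del: neg_equal_0_iff_equal neg_0_le_iff_le neg_0_less_iff_less)
qed

lemma div3_shift: "3 * s = u + 2 * h \<Longrightarrow> 9 * s = r + 2 * c + 6 * b \<Longrightarrow> (r + 2 * c) / 3 + 2 * b = u + 2 * (h::real)"
  by (simp add: field_simps)

text \<open>Seen from right to left, a formula pushes its truth value on the stack of
  \<open>s'\<close>. For a binary connective the second argument pushes first and the first one on
  top of it; uniqueness of the ternary digits forces the guessed bits to agree with them.\<close>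

lemma path_formula_sound:
  assumes "formula_in n \<phi>" "\<And>i. i < n \<Longrightarrow> xx (Suc i) = x i"
    and "path xx p (enc_formula \<phi>) s s'" "fst s' \<in> {0..1}" "residue s' = 0"
  shows "3 * fst s = fst s' + 2 * of_bool (holds \<phi> x)"
  using assms(1,3-5)
proof (induction \<phi> arbitrary: p s s')
  case (EqZero f)
  then show ?case using path_atom_sound[of n f xx x EqSym p s s'] assms(2) by simp
next
  case (GeZero f)
  then show ?case using path_atom_sound[of n f xx x GeSym p s s'] assms(2) by simp
next
  case (GtZero f)
  then show ?case using path_atom_sound[of n f xx x GtSym p s s'] assms(2) by simp
next
  case (Neg \<phi>)
  obtain S A M W G where s: "s = (S, A, M, W, G)" by (cases s)
  obtain S1 A1 M1 W1 G1 where st: "step NotSym (xx p) s (S1, A1, M1, W1, G1)"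
    and pt: "path xx p (enc_formula \<phi>) (S1, A1, M1, W1, G1) s'"
    using Neg.prems by auto
  have IH: "3 * S1 = fst s' + 2 * of_bool (holds \<phi> x)"
    using Neg.IH[OF _ pt] Neg.prems by simp
  obtain b R where "R \<in> {0..1}" "3 * S1 = R + 2 * of_bool b" "3 * S = R + 2 * of_bool (\<not> b)"
    using st by (auto simp: s)
  then show ?case using pop_unique[of R "fst s'" b "holds \<phi> x"] IH Neg.prems(3) s by simp
next
  case (Conj \<phi> \<psi>)
  obtain S A M W G where s: "s = (S, A, M, W, G)" by (cases s)
  obtain S1 A1 M1 W1 G1 s2 where st: "step AndSym (xx p) s (S1, A1, M1, W1, G1)"
    and p1: "path xx p (enc_formula \<phi>) (S1, A1, M1, W1, G1) s2"
    and p2: "path xx (ptr (enc_formula \<phi>) p) (enc_formula \<psi>) s2 s'"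
    using Conj.prems by (auto simp: path_append)
  have I2: "3 * fst s2 = fst s' + 2 * of_bool (holds \<psi> x)"
    using Conj.IH(2)[OF _ p2] Conj.prems by simp
  then have s2: "fst s2 \<in> {0..1}"
    using Conj.prems(3) by (auto simp: of_bool_def split: if_splits)
  have I1: "3 * S1 = fst s2 + 2 * of_bool (holds \<phi> x)"
    using Conj.IH(1)[OF _ p1 s2 path_formula_residue[OF p2]] Conj.prems by simp
  obtain b c R where R: "R \<in> {0..1}" "9 * S1 = R + 2 * of_bool c + 6 * of_bool b"
     "3 * S = R + 2 * of_bool (b \<and> c)"
    using st by (auto simp: s)
  have "(R + 2 * of_bool c) / 3 \<in> {0..1}" using R(1) by auto
  moreover have "(R + 2 * of_bool c) / 3 + 2 * of_bool b = fst s2 + 2 * of_bool (holds \<phi> x)"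
    by (rule div3_shift[OF I1 R(2)])
  ultimately have "(R + 2 * of_bool c) / 3 = fst s2" and b: "b = holds \<phi> x"
    using pop_unique[OF _ s2] by blast+
  then have "R + 2 * of_bool c = fst s' + 2 * of_bool (holds \<psi> x)" using I2 by simp
  then have "R = fst s'" "c = holds \<psi> x" using pop_unique[OF R(1) Conj.prems(3)] by blast+
  then show ?case using R(3) b s by simp
next
  case (Disj \<phi> \<psi>)
  obtain S A M W G where s: "s = (S, A, M, W, G)" by (cases s)
  obtain S1 A1 M1 W1 G1 s2 where st: "step OrSym (xx p) s (S1, A1, M1, W1, G1)"
    and p1: "path xx p (enc_formula \<phi>) (S1, A1, M1, W1, G1) s2"
    and p2: "path xx (ptr (enc_formula \<phi>) p) (enc_formula \<psi>) s2 s'"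
    using Disj.prems by (auto simp: path_append)
  have I2: "3 * fst s2 = fst s' + 2 * of_bool (holds \<psi> x)"
    using Disj.IH(2)[OF _ p2] Disj.prems by simp
  then have s2: "fst s2 \<in> {0..1}"
    using Disj.prems(3) by (auto simp: of_bool_def split: if_splits)
  have I1: "3 * S1 = fst s2 + 2 * of_bool (holds \<phi> x)"
    using Disj.IH(1)[OF _ p1 s2 path_formula_residue[OF p2]] Disj.prems by simp
  obtain b c R where R: "R \<in> {0..1}" "9 * S1 = R + 2 * of_bool c + 6 * of_bool b"
     "3 * S = R + 2 * of_bool (b \<or> c)"
    using st by (auto simp: s)
  have "(R + 2 * of_bool c) / 3 \<in> {0..1}" using R(1) by auto
  moreover have "(R + 2 * of_bool c) / 3 + 2 * of_bool b = fst s2 + 2 * of_bool (holds \<phi> x)"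
    by (rule div3_shift[OF I1 R(2)])
  ultimately have "(R + 2 * of_bool c) / 3 = fst s2" and b: "b = holds \<phi> x"
    using pop_unique[OF _ s2] by blast+
  then have "R + 2 * of_bool c = fst s' + 2 * of_bool (holds \<psi> x)" using I2 by simp
  then have "R = fst s'" "c = holds \<psi> x" using pop_unique[OF R(1) Disj.prems(3)] by blast+
  then show ?case using R(3) b s by simp
qed

lemma path_atom_complete:
  assumes "mpoly_in n f" "\<And>i. i < n \<Longrightarrow> xx (Suc i) = x i"
    and "\<sigma> \<in> {EqSym, GeSym, GtSym}" "residue s = 0"
    and "3 * fst s = S' + 2 * of_bool (case \<sigma> of EqSym \<Rightarrow> eval_mpoly f x = 0
     | GeSym \<Rightarrow> eval_mpoly f x \<ge> 0 | _ \<Rightarrow> eval_mpoly f x > 0)"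
  shows "\<exists>s'. path xx p (\<sigma> # enc_mpoly f) s s' \<and> residue s' = 0 \<and> fst s' = S'"
proof -
  obtain S A M W G where s: "s = (S, A, M, W, G)" by (cases s)
  \<comment> \<open>Minus the true value is the guess that ends with residue 0.\<close>
  let ?s1 = "(S', - eval_mpoly f x, 0, 0, 0) :: core"
  obtain A' M' W' G' where 1: "A' + M' * W' = - eval_mpoly f x + 0 * 0 + eval_mpoly f x"
     "path xx (next_ptr \<sigma> p) (enc_mpoly f) ?s1 (S', A', M', W', G')"
    using path_mpoly[OF assms(1), of xx x "- eval_mpoly f x" 0 0 "next_ptr \<sigma> p" S' 0] assms(2) by blast
  have "step \<sigma> (xx p) s ?s1" using assms(3-5) by (auto simp: s residue_def)
  then have "path xx p (\<sigma> # enc_mpoly f) s (S', A', M', W', G')" using 1(2) by auto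
  then show ?thesis using 1(1) by (intro exI[of _ "(S', A', M', W', G')"]) (simp add: residue_def)
qed

text \<open>The stack is prescribed at the right end while the path is built from the left; hence
  \<open>S'\<close> is a parameter, and the stacks in between arise by pushing the true values on
  it.\<close>

lemma path_formula_complete:
  assumes "formula_in n \<phi>" "\<And>i. i < n \<Longrightarrow> xx (Suc i) = x i"
    and "S' \<in> {0..1}" "3 * fst s = S' + 2 * of_bool (holds \<phi> x)" "residue s = 0"
  shows "\<exists>s'. path xx p (enc_formula \<phi>) s s' \<and> residue s' = 0 \<and> fst s' = S'"
  using assms(1,3-5)
proof (induction \<phi> arbitrary: p s S')
  case (EqZero f)
  then show ?case using path_atom_complete[of n f xx x EqSym s S' p] assms(2) by simp
next
  case (GeZero f)
  then show ?case using path_atom_complete[of n f xx x GeSym s S' p] assms(2) by simp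
next
  case (GtZero f)
  then show ?case using path_atom_complete[of n f xx x GtSym s S' p] assms(2) by simp
next
  case (Neg \<phi>)
  obtain S A M W G where s: "s = (S, A, M, W, G)" by (cases s)
  let ?S1 = "(S' + 2 * of_bool (holds \<phi> x)) / 3"
  have "step NotSym (xx p) s (?S1, 0, 0, 0, 0)"
    using Neg.prems by (auto simp: s residue_def intro!: exI[of _ "holds \<phi> x"] bexI[of _ S'])
  moreover obtain s' where "path xx p (enc_formula \<phi>) (?S1, 0, 0, 0, 0) s'" "residue s' = 0" "fst s' = S'"
    using Neg.IH[of S' "(?S1, 0, 0, 0, 0)" p] Neg.prems by (auto simp: residue_def)
  ultimately show ?case by auto
next
  case (Conj \<phi> \<psi>)
  obtain S A M W G where s: "s = (S, A, M, W, G)" by (cases s)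
  let ?S2 = "(S' + 2 * of_bool (holds \<psi> x)) / 3"
  let ?S1 = "(?S2 + 2 * of_bool (holds \<phi> x)) / 3"
  have "step AndSym (xx p) s (?S1, 0, 0, 0, 0)"
  proof -
    have "\<exists>b c. \<exists>R\<in>{0..1}. 9 * ?S1 = R + 2 * of_bool c + 6 * of_bool b \<and> 3 * S = R + 2 * of_bool (b \<and> c)"
      by (rule exI[of _ "holds \<phi> x"], rule exI[of _ "holds \<psi> x"], rule bexI[of _ S'])
        (use Conj.prems s in auto)
    then show ?thesis using Conj.prems by (simp add: s residue_def)
  qed
  moreover have "?S2 \<in> {0..1}" using Conj.prems(2) by auto
  then obtain s2 where 2: "path xx p (enc_formula \<phi>) (?S1, 0, 0, 0, 0) s2" "residue s2 = 0" "fst s2 = ?S2"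
    using Conj.IH(1)[of ?S2 "(?S1, 0, 0, 0, 0)" p] Conj.prems by (auto simp: residue_def)
  moreover obtain s' where "path xx (ptr (enc_formula \<phi>) p) (enc_formula \<psi>) s2 s'" "residue s' = 0" "fst s' = S'"
    using Conj.IH(2)[of S' s2 "ptr (enc_formula \<phi>) p"] Conj.prems 2 by auto
  ultimately show ?case by (auto simp: path_append)
next
  case (Disj \<phi> \<psi>)
  obtain S A M W G where s: "s = (S, A, M, W, G)" by (cases s)
  let ?S2 = "(S' + 2 * of_bool (holds \<psi> x)) / 3"
  let ?S1 = "(?S2 + 2 * of_bool (holds \<phi> x)) / 3"
  have "step OrSym (xx p) s (?S1, 0, 0, 0, 0)"
  proof -
    have "\<exists>b c. \<exists>R\<in>{0..1}. 9 * ?S1 = R + 2 * of_bool c + 6 * of_bool b \<and> 3 * S = R + 2 * of_bool (b \<or> c)"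
      by (rule exI[of _ "holds \<phi> x"], rule exI[of _ "holds \<psi> x"], rule bexI[of _ S'])
        (use Disj.prems s in auto)
    then show ?thesis using Disj.prems by (simp add: s residue_def)
  qed
  moreover have "?S2 \<in> {0..1}" using Disj.prems(2) by auto
  then obtain s2 where 2: "path xx p (enc_formula \<phi>) (?S1, 0, 0, 0, 0) s2" "residue s2 = 0" "fst s2 = ?S2"
    using Disj.IH(1)[of ?S2 "(?S1, 0, 0, 0, 0)" p] Disj.prems by (auto simp: residue_def)
  moreover obtain s' where "path xx (ptr (enc_formula \<phi>) p) (enc_formula \<psi>) s2 s'" "residue s' = 0" "fst s' = S'"
    using Disj.IH(2)[of S' s2 "ptr (enc_formula \<phi>) p"] Disj.prems 2 by auto
  ultimately show ?case by (auto simp: path_append)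
qed

lemma path_VarSym: "path xx p (replicate n VarSym) s s' \<Longrightarrow> fst s' = fst s"
proof (induction n arbitrary: s)
  case (Suc n)
  then obtain s1 where "step VarSym (xx p) s s1" "fst s' = fst s1" by auto
  then show ?case by (cases s; cases s1) auto
qed simp

lemma path_VarSym_refl: "path xx p (replicate n VarSym) s s"
proof (induction n)
  case (Suc n)
  have "step VarSym (xx p) s s" by (cases s) simp
  then show ?case using Suc.IH by (simp, blast)
qed simp

definition etr_word :: "nat \<Rightarrow> qf_formula \<Rightarrow> sym list" where
  "etr_word n \<phi> = replicate n VarSym @ enc_formula \<phi>"

text \<open>The code \<open>2 / 3\<close> is the bit true on top of the empty stack 0.\<close>

lemma path_etr_sound:
  assumes "formula_in n \<phi>" "path xx 0 (etr_word n \<phi>) s s'"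
    and "3 * fst s = 2" "fst s' = 0" "residue s' = 0"
  shows "holds \<phi> (\<lambda>i. xx (Suc i))"
proof -
  obtain s1 where s1: "path xx 0 (replicate n VarSym) s s1" 
     "path xx (ptr (replicate n VarSym) 0) (enc_formula \<phi>) s1 s'"
    using assms(2) by (auto simp: etr_word_def path_append)
  have "3 * fst s1 = fst s' + 2 * of_bool (holds \<phi> (\<lambda>i. xx (Suc i)))"
    using path_formula_sound[OF assms(1) _ s1(2)] assms by simp
  then show ?thesis using path_VarSym[OF s1(1)] assms by (auto simp: of_bool_def split: if_splits)
qed

lemma path_etr_complete:
  assumes "formula_in n \<phi>" "holds \<phi> x" "\<And>i. i < n \<Longrightarrow> xx (Suc i) = x i"
  shows "\<exists>s s'. path xx 0 (etr_word n \<phi>) s s' \<and> 3 * fst s = 2 \<and> fst s' = 0 \<and> residue s' = 0"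
proof -
  let ?s = "(2 / 3, 0, 0, 0, 0) :: core"
  obtain s' where "path xx (ptr (replicate n VarSym) 0) (enc_formula \<phi>) ?s s'" "residue s' = 0" "fst s' = 0"
    using path_formula_complete[OF assms(1), of xx x 0 ?s "ptr (replicate n VarSym) 0"] assms(2,3)
    by (auto simp: residue_def)
  moreover have "path xx 0 (replicate n VarSym) ?s ?s" by (rule path_VarSym_refl)
  ultimately have "path xx 0 (etr_word n \<phi>) ?s s'" unfolding etr_word_def path_append by blast
  then show ?thesis using \<open>residue s' = 0\<close> \<open>fst s' = 0\<close> by (intro exI[of _ ?s] exI[of _ s']) simp
qed


section \<open>The polynomial and its superlevel set\<close>

fun fld_index :: "fld \<Rightarrow> nat" where
  "fld_index FX = 0" | "fld_index FS = 1" | "fld_index FA = 2" | "fld_index FM = 3"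
| "fld_index FW = 4" | "fld_index FG = 5" | "fld_index FU = 6" | "fld_index FB = 7"
| "fld_index FC = 8" | "fld_index FP = 9" | "fld_index FQ = 10" | "fld_index FZ = 11"

definition flds :: "fld list" where
  "flds = [FX, FS, FA, FM, FW, FG, FU, FB, FC, FP, FQ, FZ]"

lemma fld_index_less [simp]: "fld_index l < 12"
  by (cases l) auto

lemma flds_fld_index [simp]: "flds ! fld_index l = l"
  by (cases l) (auto simp: flds_def)

lemma length_flds [simp]: "length flds = 12"
  by (simp add: flds_def)

lemma fld_index_inj [simp]: "fld_index l = fld_index l' \<longleftrightarrow> l = l'"
  by (metis flds_fld_index)

lemma flds_nth_eq: "i < 12 \<Longrightarrow> flds ! i = l \<longleftrightarrow> i = fld_index l"
proof -
  have "distinct flds" by (simp add: flds_def)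
  then show "i < 12 \<Longrightarrow> ?thesis" by (metis fld_index_less flds_fld_index length_flds nth_eq_iff_index_eq)
qed

text \<open>A block may play several roles, such as \<open>Nxt\<close> and \<open>Last\<close>, so
  occurrences of a field are counted over all roles that \<open>F\<close> admits.\<close>

definition exponents :: "(blk \<Rightarrow> bool) \<Rightarrow> (blk \<times> fld) list \<Rightarrow> nat list" where
  "exponents F vs = map (\<lambda>l. length (filter (\<lambda>v. snd v = l \<and> F (fst v)) vs)) flds"

text \<open>The last block has no letter that could carry a mark, hence the bound on
  \<open>Ptr\<close>. When \<open>p\<close> is not below \<open>N\<close>, the variable drops out
  and counts as 1 in \<open>blks\<close>.\<close>

definition blk_at :: "nat \<Rightarrow> nat \<Rightarrow> nat \<Rightarrow> nat \<Rightarrow> blk \<Rightarrow> bool" where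
  "blk_at N i p j b = (case b of Cur \<Rightarrow> j = i | Nxt \<Rightarrow> j = Suc i | Ptr \<Rightarrow> j = p \<and> j < N | Last \<Rightarrow> j = N)"

definition place :: "nat \<Rightarrow> nat \<Rightarrow> nat \<Rightarrow> int \<times> (blk \<times> fld) list \<Rightarrow> monomial" where
  "place N i p m = (fst m, concat (map (\<lambda>j. exponents (blk_at N i p j) (snd m)) [0..<Suc N]))"

definition blks :: "nat \<Rightarrow> nat \<Rightarrow> nat \<Rightarrow> (nat \<Rightarrow> real) \<Rightarrow> blk \<Rightarrow> fld \<Rightarrow> real" where
  "blks N i p y b l = (case b of Cur \<Rightarrow> y (12 * i + fld_index l) | Nxt \<Rightarrow> y (12 * Suc i + fld_index l)
     | Ptr \<Rightarrow> if p < N then y (12 * p + fld_index l) else 1 | Last \<Rightarrow> y (12 * N + fld_index l))"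

lemma length_exponents [simp]: "length (exponents F vs) = 12"
  by (simp add: exponents_def)

lemma length_concat_blocks:
  "(\<And>j. length (f j) = c) \<Longrightarrow> length (concat (map f [0..<n])) = c * n"
  by (induction n) auto

lemma nth_concat_blocks:
  assumes "\<And>j. length (f j) = c" "j < n" "l < c"
  shows "concat (map f [0..<n]) ! (c * j + l) = f j ! l"
  using assms(2)
proof (induction n)
  case (Suc n)
  have len: "length (concat (map f [0..<n])) = c * n"
    using assms(1) by (rule length_concat_blocks)
  show ?case
  proof (cases "j = n")
    case True
    then show ?thesis using len by (simp add: nth_append)
  next
    case False
    then have "j < n" using Suc.prems by simp
    then have "c * Suc j \<le> c * n" by (intro mult_le_mono2) simp
    then have "c * j + l < c * n" using assms(3) by simp
    then show ?thesis using len Suc.IH[OF \<open>j < n\<close>] by (simp add: nth_append)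
  qed
qed simp

lemma prod_lessThan_add: "(\<Prod>i<a + b. g i) = (\<Prod>i<a. g i) * (\<Prod>i<b. g (a + i :: nat))"
  for g :: "nat \<Rightarrow> real"
  by (induction b) (auto simp: mult.assoc)

lemma prod_blocks: "(\<Prod>i<c * n. g i) = (\<Prod>j<n. \<Prod>l<c. g (c * j + l :: nat))"
  for g :: "nat \<Rightarrow> real"
  by (induction n) (auto simp: prod_lessThan_add add.commute[of c])

text \<open>Induction on the factors: each raises a single exponent by one, or none if it is a
  pointer out of range.\<close>

lemma prod_exponents:
  assumes "i < N"
  shows "(\<Prod>j<Suc N. \<Prod>l<12. y (12 * j + l) ^ (exponents (blk_at N i p j) vs ! l)) =
    (\<Prod>(b, l)\<leftarrow>vs. blks N i p y b l)"
proof (induction vs)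
  case Nil
  then show ?case by (simp add: exponents_def)
next
  case (Cons v vs)
  obtain b l' where v: "v = (b, l')" by (cases v)
  let ?F = "blk_at N i p"
  have split: "y (12 * j + l) ^ (exponents (?F j) (v # vs) ! l) =
      y (12 * j + l) ^ (exponents (?F j) vs ! l) *
      (if l = fld_index l' then (if ?F j b then y (12 * j + l) else 1) else 1)" if "l < 12" for j l
    using that flds_nth_eq[OF that, of l'] by (auto simp: exponents_def v)
  have inner: "(\<Prod>l<12. if l = fld_index l' then (if ?F j b then y (12 * j + l) else 1) else 1) =
      (if ?F j b then y (12 * j + fld_index l') else 1)" for j
    by (simp add: prod.delta)
  have outer: "(\<Prod>j<Suc N. if ?F j b then y (12 * j + fld_index l') else 1) = blks N i p y b l'"
  proof (cases b)
    case Ptr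
    have "(\<Prod>j<Suc N. if ?F j b then y (12 * j + fld_index l') else 1) =
        (\<Prod>j<Suc N. if j = p then (if p < N then y (12 * p + fld_index l') else 1) else 1)"
      by (intro prod.cong) (auto simp: blk_at_def Ptr)
    also have "\<dots> = blks N i p y b l'"
      by (subst prod.delta) (auto simp: blks_def Ptr)
    finally show ?thesis .
  qed (use assms in \<open>auto simp: blk_at_def blks_def prod.delta simp del: prod.lessThan_Suc\<close>)
  have "(\<Prod>j<Suc N. \<Prod>l<12. y (12 * j + l) ^ (exponents (?F j) (v # vs) ! l)) =
    (\<Prod>j<Suc N. (\<Prod>l<12. y (12 * j + l) ^ (exponents (?F j) vs ! l)) *
      (if ?F j b then y (12 * j + fld_index l') else 1))"
    unfolding inner[symmetric] prod.distrib[symmetric]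
    by (intro prod.cong refl split) auto
  also have "\<dots> = (\<Prod>(b, l)\<leftarrow>vs. blks N i p y b l) * blks N i p y b l'"
    unfolding prod.distrib Cons.IH outer ..
  finally show ?case by (simp add: v mult.commute)
qed

lemma length_place: "length (snd (place N i p m)) = 12 * Suc N"
  unfolding place_def snd_conv by (rule length_concat_blocks) simp

lemma eval_place:
  assumes "i < N"
  shows "eval_monomial (place N i p m) y = ev_mon (blks N i p y) m"
proof -
  have "(\<Prod>j<length (snd (place N i p m)). y j ^ (snd (place N i p m) ! j)) =
    (\<Prod>j<Suc N. \<Prod>l<12. y (12 * j + l) ^ (snd (place N i p m) ! (12 * j + l)))"
    unfolding length_place by (rule prod_blocks)
  also have "\<dots> = (\<Prod>j<Suc N. \<Prod>l<12. y (12 * j + l) ^ (exponents (blk_at N i p j) (snd m) ! l))"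
    unfolding place_def snd_conv by (intro prod.cong refl) (subst nth_concat_blocks, auto)
  also have "\<dots> = (\<Prod>(b, l)\<leftarrow>snd m. blks N i p y b l)" using prod_exponents[OF assms] .
  finally show ?thesis by (simp add: eval_monomial_def ev_mon_def place_def)
qed

definition neg_squares :: "lpoly list \<Rightarrow> lpoly" where
  "neg_squares E = concat (map (\<lambda>e. const (-1) \<odot> (e \<odot> e)) E)"

lemma ev_neg_squares: "ev \<rho> (neg_squares E) = - (\<Sum>e\<leftarrow>E. (ev \<rho> e)\<^sup>2)"
proof (induction E)
  case (Cons e E)
  have "neg_squares (e # E) = (const (-1) \<odot> (e \<odot> e)) @ neg_squares E"
    by (simp add: neg_squares_def)
  then show ?case using Cons by (simp add: ev_append power2_eq_square)
qed (simp add: neg_squares_def ev_def)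

lemma sum_squares_zero: "(\<Sum>e\<leftarrow>E. (ev \<rho> e)\<^sup>2) = 0 \<longleftrightarrow> solves \<rho> E"
proof (induction E)
  case (Cons e E)
  have "0 \<le> (\<Sum>e\<leftarrow>E. (ev \<rho> e)\<^sup>2)" by (auto intro!: sum_list_nonneg)
  from add_nonneg_eq_0_iff[OF zero_le_power2[of "ev \<rho> e"] this]
  show ?case using Cons by (auto simp: solves_def)
qed (simp add: solves_def)

text \<open>The roots of \<open>roots k\<close> are \<open>1, \<dots>, k\<close>, which gives \<open>k\<close> translates of the solution set.\<close>

definition roots :: "nat \<Rightarrow> lpoly" where
  "roots k = foldr (\<lambda>r p. (var Last FZ \<ominus> const (int r)) \<odot> p) [1..<Suc k] (const 1)"

lemma ev_roots: "ev \<rho> (roots k) = 0 \<longleftrightarrow> (\<exists>r\<in>{1..k}. \<rho> Last FZ = real r)"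
proof -
  have "ev \<rho> (foldr (\<lambda>r p. (var Last FZ \<ominus> const (int r)) \<odot> p) rs (const 1)) = 0 \<longleftrightarrow>
      (\<exists>r\<in>set rs. \<rho> Last FZ = real r)" for rs
    by (induction rs) auto
  from this[of "[1..<Suc k]"] show ?thesis unfolding roots_def by auto
qed

text \<open>In the first stage, \<open>Ptr\<close> is the first block.\<close>

definition boundary_eqs :: "nat \<Rightarrow> lpoly list" where
  "boundary_eqs k = [const 3 \<odot> var Ptr FS \<ominus> const 2, var Last FS,
     var Last FA \<oplus> var Last FM \<odot> var Last FW, roots k]"

definition boundary :: "nat \<Rightarrow> lpoly" where
  "boundary k = const 1 @ neg_squares (boundary_eqs k)"

definition stage_poly :: "nat \<Rightarrow> sym list \<Rightarrow> nat \<Rightarrow> lpoly" where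
  "stage_poly k w i = (if i = 0 then boundary k else []) @ neg_squares (eqs (w ! i))"

definition ptr_at :: "sym list \<Rightarrow> nat \<Rightarrow> nat" where
  "ptr_at w i = ptr (take i w) 0"

definition clsc_poly :: "nat \<Rightarrow> sym list \<Rightarrow> int_mpoly" where
  "clsc_poly k w = concat (map (\<lambda>i. map (place (length w) i (ptr_at w i)) (stage_poly k w i))
     [0..<length w])"

abbreviation blks_at :: "sym list \<Rightarrow> (nat \<Rightarrow> real) \<Rightarrow> nat \<Rightarrow> blk \<Rightarrow> fld \<Rightarrow> real" where
  "blks_at w y i \<equiv> blks (length w) i (ptr_at w i) y"

lemma mpoly_in_clsc_poly: "mpoly_in (12 * Suc (length w)) (clsc_poly k w)"
proof -
  have "length (snd m) = 12 * Suc (length w)" if "m \<in> set (clsc_poly k w)" for m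
    using that length_place by (auto simp: clsc_poly_def)
  then show ?thesis by (auto simp: mpoly_in_def)
qed

lemma eval_mpoly_concat:
  "eval_mpoly (concat (map f [0..<n])) y = (\<Sum>i<n. eval_mpoly (f i) y)"
  by (induction n) (auto simp: eval_mpoly_def)

lemma eval_mpoly_place:
  "i < N \<Longrightarrow> eval_mpoly (map (place N i p) q) y = ev (blks N i p y) q"
  by (induction q) (auto simp: eval_mpoly_def ev_def eval_place)

definition solution :: "nat \<Rightarrow> sym list \<Rightarrow> (nat \<Rightarrow> real) \<Rightarrow> bool" where
  "solution k w y \<longleftrightarrow> solves (blks_at w y 0) (boundary_eqs k) \<and>
     (\<forall>i<length w. solves (blks_at w y i) (eqs (w ! i)))"

text \<open>The value is 1 minus a sum of squares, so it reaches 1 only where every equation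
  holds.\<close>

lemma eval_clsc_poly:
  assumes "w \<noteq> []"
  shows "eval_mpoly (clsc_poly k w) y \<ge> 1 \<longleftrightarrow> solution k w y"
proof -
  let ?sq = "\<lambda>i E. (\<Sum>e\<leftarrow>E. (ev (blks_at w y i) e)\<^sup>2)"
  have "eval_mpoly (clsc_poly k w) y = (\<Sum>i<length w. ev (blks_at w y i) (stage_poly k w i))"
    unfolding clsc_poly_def eval_mpoly_concat by (intro sum.cong) (auto simp: eval_mpoly_place)
  also have "\<dots> = (\<Sum>i<length w. (if i = 0 then 1 - ?sq 0 (boundary_eqs k) else 0) - ?sq i (eqs (w ! i)))"
    by (intro sum.cong) (auto simp: stage_poly_def boundary_def ev_append ev_neg_squares ev_def[of _ "[]"])
  also have "\<dots> = 1 - ?sq 0 (boundary_eqs k) - (\<Sum>i<length w. ?sq i (eqs (w ! i)))"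
    using assms by (simp add: sum_subtractf sum.delta)
  finally have *: "eval_mpoly (clsc_poly k w) y = \<dots>" .
  have nn: "0 \<le> ?sq i E" for i E by (auto intro!: sum_list_nonneg)
  have "0 \<le> (\<Sum>i<length w. ?sq i (eqs (w ! i)))" by (intro sum_nonneg nn)
  then have "eval_mpoly (clsc_poly k w) y \<ge> 1 \<longleftrightarrow>
      ?sq 0 (boundary_eqs k) = 0 \<and> (\<Sum>i<length w. ?sq i (eqs (w ! i))) = 0"
    using nn[of 0 "boundary_eqs k"] unfolding * by linarith
  also have "(\<Sum>i<length w. ?sq i (eqs (w ! i))) = 0 \<longleftrightarrow> (\<forall>i<length w. ?sq i (eqs (w ! i)) = 0)"
    by (subst sum_nonneg_eq_0_iff) (auto intro: nn)
  finally show ?thesis unfolding solution_def sum_squares_zero .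
qed

lemma solves_boundary:
  "solves \<rho> (boundary_eqs k) \<longleftrightarrow> 3 * \<rho> Ptr FS = 2 \<and> \<rho> Last FS = 0 \<and>
     \<rho> Last FA + \<rho> Last FM * \<rho> Last FW = 0 \<and> (\<exists>r\<in>{1..k}. \<rho> Last FZ = real r)"
  by (auto simp: solves_def boundary_eqs_def ev_roots)

text \<open>Turns the nested existentials into one sequence of states, indexed like the
  blocks.\<close>

lemma path_iff_steps:
  "path xx p w s s' \<longleftrightarrow> (\<exists>st. st 0 = s \<and> st (length w) = s' \<and>
     (\<forall>i<length w. step (w ! i) (xx (ptr (take i w) p)) (st i) (st (Suc i))))"
proof (induction w arbitrary: p s)
  case Nil
  then show ?case by (auto intro: exI[of _ "\<lambda>_. s"])
next
  case (Cons \<sigma> w)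
  let ?P = "\<lambda>st. st 0 = s \<and> st (length (\<sigma> # w)) = s' \<and>
     (\<forall>i<length (\<sigma> # w). step ((\<sigma> # w) ! i) (xx (ptr (take i (\<sigma> # w)) p)) (st i) (st (Suc i)))"
  show ?case
  proof
    assume "path xx p (\<sigma> # w) s s'"
    then obtain s1 st where st: "step \<sigma> (xx p) s s1" "st 0 = s1" "st (length w) = s'"
      "\<forall>i<length w. step (w ! i) (xx (ptr (take i w) (next_ptr \<sigma> p))) (st i) (st (Suc i))"
      by (simp only: path.simps Cons.IH) blast
    have "?P (\<lambda>i. if i = 0 then s else st (i - 1))"
      using st by (auto simp: less_Suc_eq_0_disj)
    then show "\<exists>st. ?P st" by (rule exI[of ?P])
  next
    assume "\<exists>st. ?P st"
    then obtain st where P: "?P st" by (rule exE)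
    then have st: "st 0 = s" "st (Suc (length w)) = s'"
      by simp_all
    have all: "step ((\<sigma> # w) ! i) (xx (ptr (take i (\<sigma> # w)) p)) (st i) (st (Suc i))"
      if "i < Suc (length w)" for i
      using P that by simp
    have "step \<sigma> (xx p) s (st 1)" using all[of 0] st(1) by simp
    moreover have "path xx (next_ptr \<sigma> p) w (st 1) s'"
      unfolding Cons.IH by (rule exI[of _ "\<lambda>i. st (Suc i)"]) (use st(2) all[of "Suc _"] in simp)
    ultimately show "path xx p (\<sigma> # w) s s'" unfolding path.simps by blast
  qed
qed

section \<open>Solutions and satisfying assignments\<close>

lemma solution_imp_holds:
  assumes "formula_in n \<phi>" "solution k (etr_word n \<phi>) y"
  shows "\<exists>x. holds \<phi> x"
proof -
  let ?w = "etr_word n \<phi>"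
  let ?N = "length ?w"
  have N: "0 < ?N" by (cases \<phi>) (auto simp: etr_word_def)
  \<comment> \<open>\<open>fld_index FX\<close> is 0, so \<open>12 * p\<close> addresses that field;
    the value 1 for other pointers agrees with \<open>blks\<close>.\<close>
  let ?xx = "\<lambda>p. if p < ?N then y (12 * p) else 1"
  let ?st = "\<lambda>i. core_of (\<lambda>l. y (12 * i + fld_index l))"
  have "step (?w ! i) (?xx (ptr (take i ?w) 0)) (?st i) (?st (Suc i))" if "i < ?N" for i
  proof -
    have "solves (blks_at ?w y i) (eqs (?w ! i))" using assms(2) that by (simp add: solution_def)
    from solves_step[OF this]
    have "step (?w ! i) (blks_at ?w y i Ptr FX) (core_of (blks_at ?w y i Cur)) (core_of (blks_at ?w y i Nxt))" .
    moreover have "blks_at ?w y i Cur = (\<lambda>l. y (12 * i + fld_index l))"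
      "blks_at ?w y i Nxt = (\<lambda>l. y (12 * Suc i + fld_index l))"
      "blks_at ?w y i Ptr FX = ?xx (ptr (take i ?w) 0)"
      by (simp_all add: blks_def fun_eq_iff ptr_at_def)
    ultimately show ?thesis by (simp only:)
  qed
  then have "path ?xx 0 ?w (?st 0) (?st ?N)" unfolding path_iff_steps by (intro exI[of _ ?st]) simp
  moreover have "3 * fst (?st 0) = 2" "fst (?st ?N) = 0" "residue (?st ?N) = 0"
    using assms(2) N unfolding solution_def solves_boundary
    by (auto simp: blks_def core_of_def ptr_at_def residue_def)
  ultimately show ?thesis using path_etr_sound[OF assms(1)] by blast
qed

lemma holds_imp_solution:
  assumes "formula_in n \<phi>" "holds \<phi> x" "1 \<le> k"
  shows "\<exists>y \<in> topspace (Euclidean_space (12 * Suc (length (etr_word n \<phi>)))). solution k (etr_word n \<phi>) y"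
proof -
  let ?w = "etr_word n \<phi>"
  let ?N = "length ?w"
  \<comment> \<open>Strict, since a formula has at least one letter; so every variable has a block
    below \<open>?N\<close>.\<close>
  have N: "n < ?N" by (cases \<phi>) (auto simp: etr_word_def)
  define xx where "xx p = (if p < ?N then (if p = 0 then 0 else x (p - 1)) else 1)" for p
  have "xx (Suc i) = x i" if "i < n" for i using that N by (simp add: xx_def)
  from path_etr_complete[of n \<phi> x xx, OF assms(1,2) this]
  obtain st where st: "3 * fst (st 0) = 2" "fst (st ?N) = 0" "residue (st ?N) = 0"
    "\<And>i. i < ?N \<Longrightarrow> step (?w ! i) (xx (ptr_at ?w i)) (st i) (st (Suc i))"
    unfolding path_iff_steps ptr_at_def by blast
  \<comment> \<open>The witnesses of a block are packed into one tuple, so that a single choice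
    function \<open>a\<close> arises.\<close>
  have "\<forall>i. \<exists>a. i < ?N \<longrightarrow> (\<forall>\<rho>. \<rho> Ptr FX = xx (ptr_at ?w i) \<and> core_of (\<rho> Cur) = st i \<and>
     core_of (\<rho> Nxt) = st (Suc i) \<and> \<rho> Cur FU = fst a \<and> \<rho> Cur FB = fst (snd a) \<and>
     \<rho> Cur FC = fst (snd (snd a)) \<and> \<rho> Cur FP = fst (snd (snd (snd a))) \<and>
     \<rho> Cur FQ = snd (snd (snd (snd a))) \<longrightarrow> solves \<rho> (eqs (?w ! i)))"
  proof
    fix i
    show "\<exists>a. i < ?N \<longrightarrow> (\<forall>\<rho>. \<rho> Ptr FX = xx (ptr_at ?w i) \<and> core_of (\<rho> Cur) = st i \<and>
       core_of (\<rho> Nxt) = st (Suc i) \<and> \<rho> Cur FU = fst a \<and> \<rho> Cur FB = fst (snd a) \<and>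
       \<rho> Cur FC = fst (snd (snd a)) \<and> \<rho> Cur FP = fst (snd (snd (snd a))) \<and>
       \<rho> Cur FQ = snd (snd (snd (snd a))) \<longrightarrow> solves \<rho> (eqs (?w ! i)))"
    proof (cases "i < ?N")
      case True
      from step_solves[OF st(4)[OF this]] obtain U B C P Q where
        "\<forall>\<rho>. \<rho> Ptr FX = xx (ptr_at ?w i) \<and> core_of (\<rho> Cur) = st i \<and> core_of (\<rho> Nxt) = st (Suc i) \<and>
     \<rho> Cur FU = U \<and> \<rho> Cur FB = B \<and> \<rho> Cur FC = C \<and> \<rho> Cur FP = P \<and> \<rho> Cur FQ = Q
     \<longrightarrow> solves \<rho> (eqs (?w ! i))" by blast
      then show ?thesis by (intro exI[of _ "(U, B, C, P, Q)"]) simp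
    qed simp
  qed
  then obtain a where a: "\<And>i \<rho>. i < ?N \<Longrightarrow> \<rho> Ptr FX = xx (ptr_at ?w i) \<Longrightarrow> core_of (\<rho> Cur) = st i \<Longrightarrow>
     core_of (\<rho> Nxt) = st (Suc i) \<Longrightarrow> \<rho> Cur FU = fst (a i) \<Longrightarrow> \<rho> Cur FB = fst (snd (a i)) \<Longrightarrow>
     \<rho> Cur FC = fst (snd (snd (a i))) \<Longrightarrow> \<rho> Cur FP = fst (snd (snd (snd (a i)))) \<Longrightarrow>
     \<rho> Cur FQ = snd (snd (snd (snd (a i)))) \<Longrightarrow> solves \<rho> (eqs (?w ! i))"
    by metis
  \<comment> \<open>\<open>FZ\<close> gets 1, which is a root of \<open>roots k\<close> because
    \<open>1 <= k\<close>.\<close>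
  define val where "val j l = (case l of FX \<Rightarrow> xx j
     | FS \<Rightarrow> fst (st j) | FA \<Rightarrow> fst (snd (st j)) | FM \<Rightarrow> fst (snd (snd (st j)))
     | FW \<Rightarrow> fst (snd (snd (snd (st j)))) | FG \<Rightarrow> snd (snd (snd (snd (st j))))
     | FU \<Rightarrow> fst (a j) | FB \<Rightarrow> fst (snd (a j)) | FC \<Rightarrow> fst (snd (snd (a j)))
     | FP \<Rightarrow> fst (snd (snd (snd (a j)))) | FQ \<Rightarrow> snd (snd (snd (snd (a j)))) | FZ \<Rightarrow> 1)" for j l
  define y where "y m = (if m < 12 * Suc ?N then val (m div 12) (flds ! (m mod 12)) else 0)" for m
  have y: "y (12 * j + fld_index l) = val j l" if "j \<le> ?N" for j l
  proof -
    have "12 * j + fld_index l < 12 * j + 12" by simp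
    also have "\<dots> \<le> 12 * Suc ?N" using that by simp
    finally have "12 * j + fld_index l < 12 * Suc ?N" .
    then show ?thesis using fld_index_less[of l] by (simp add: y_def)
  qed
  have core: "core_of (\<lambda>l. y (12 * j + fld_index l)) = st j" if "j \<le> ?N" for j
    unfolding y[OF that] by (simp add: core_of_def val_def)
  have "solves (blks_at ?w y i) (eqs (?w ! i))" if "i < ?N" for i
  proof (rule a[OF that])
    show "blks_at ?w y i Ptr FX = xx (ptr_at ?w i)"
      using y[of "ptr_at ?w i" FX] by (auto simp: blks_def val_def xx_def)
    have C: "blks_at ?w y i Cur = (\<lambda>l. y (12 * i + fld_index l))"
      and S: "blks_at ?w y i Nxt = (\<lambda>l. y (12 * Suc i + fld_index l))"
      by (simp_all add: blks_def fun_eq_iff)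
    show "core_of (blks_at ?w y i Cur) = st i" "core_of (blks_at ?w y i Nxt) = st (Suc i)"
      unfolding C S using core[of i] core[of "Suc i"] that by (simp_all del: mult_Suc_right)
    show "blks_at ?w y i Cur FU = fst (a i)" "blks_at ?w y i Cur FB = fst (snd (a i))"
      "blks_at ?w y i Cur FC = fst (snd (snd (a i)))" "blks_at ?w y i Cur FP = fst (snd (snd (snd (a i))))"
      "blks_at ?w y i Cur FQ = snd (snd (snd (snd (a i))))"
      unfolding C using y[of i] that by (simp_all add: val_def del: fld_index.simps)
  qed
  moreover have "solves (blks_at ?w y 0) (boundary_eqs k)"
  proof -
    have "blks_at ?w y 0 Ptr FS = fst (st 0)"
      using y[of 0 FS] N by (auto simp: blks_def ptr_at_def val_def)
    moreover have "blks_at ?w y 0 Last l = val ?N l" for l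
      using y[of ?N l] by (simp add: blks_def)
    ultimately show ?thesis using st(1-3) assms(3)
      by (simp add: solves_boundary val_def residue_def case_prod_beta)
  qed
  ultimately have "solution k ?w y" by (simp add: solution_def)
  moreover have "y \<in> topspace (Euclidean_space (12 * Suc ?N))"
    by (simp add: topspace_Euclidean_space y_def)
  ultimately show ?thesis by blast
qed

section \<open>Counting connected components\<close>

lemma solves_cong:
  assumes "\<And>b l. l \<noteq> FZ \<Longrightarrow> \<rho> b l = \<rho>' b l"
  shows "solves \<rho> (eqs \<sigma>) = solves \<rho>' (eqs \<sigma>)"
  using assms by (cases \<sigma>) (simp_all add: eqs_simps)

text \<open>Only \<open>roots k\<close> mentions \<open>FZ\<close>, and only in the last block;
  hence a solution can be moved to any of the \<open>k\<close> slices.\<close>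

lemma solution_upd:
  assumes "solution k w y" "r \<in> {1..k}" "w \<noteq> []"
  shows "solution k w (y(12 * length w + fld_index FZ := real r))"
proof -
  let ?y = "y(12 * length w + fld_index FZ := real r)"
  have ne: "12 * j + fld_index l = 12 * j' + fld_index l' \<longleftrightarrow> j = j' \<and> l = l'" for j l j' l'
  proof
    assume "12 * j + fld_index l = 12 * j' + fld_index l'"
    then have "(12 * j + fld_index l) div 12 = (12 * j' + fld_index l') div 12"
      "(12 * j + fld_index l) mod 12 = (12 * j' + fld_index l') mod 12" by simp_all
    then show "j = j' \<and> l = l'" by simp
  qed simp
  have same: "blks_at w ?y i b l = blks_at w y i b l" if "l \<noteq> FZ" for i b l
    using that unfolding blks_def fun_upd_apply ne by (cases b) simp_all
  have "blks_at w ?y 0 Last FZ = real r" by (simp add: blks_def)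
  then have "solves (blks_at w ?y 0) (boundary_eqs k)"
    using assms same[of _ 0] unfolding solution_def solves_boundary by auto
  moreover have "solves (blks_at w ?y i) (eqs (w ! i))" if "i < length w" for i
  proof -
    have "solves (blks_at w ?y i) (eqs (w ! i)) = solves (blks_at w y i) (eqs (w ! i))"
      by (rule solves_cong) (rule same)
    then show ?thesis using assms(1) that by (simp add: solution_def)
  qed
  ultimately show ?thesis by (simp add: solution_def)
qed

text \<open>By the intermediate value theorem, a connected set through points with different integer
  values of \<open>h\<close> would attain a half-integer.\<close>

lemma at_least_components_slices:
  fixes X :: "'a topology" and h :: "'a \<Rightarrow> real"
  assumes "continuous_map X euclideanreal h" "h ` topspace X \<subseteq> real ` {1..k}"
    and "\<And>r. r \<in> {1..k} \<Longrightarrow> P r \<in> topspace X \<and> h (P r) = real r"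
  shows "at_least_components k X"
proof -
  let ?c = "\<lambda>r. connected_component_of_set X (P r)"
  have "inj_on ?c {1..k}"
  proof (rule linorder_inj_onI)
    fix r s :: nat assume rs: "r < s" "r \<in> {1..k}" "s \<in> {1..k}"
    show "?c r \<noteq> ?c s"
    proof
      assume "?c r = ?c s"
      then have "connected_component_of X (P r) (P s)"
        using assms(3)[OF rs(3)] connected_component_of_refl by (metis mem_Collect_eq)
      then obtain T where T: "connectedin X T" "P r \<in> T" "P s \<in> T"
        unfolding connected_component_of_def by blast
      have "connected (h ` T)"
        using connectedin_continuous_map_image[OF assms(1) T(1)] by simp
      moreover have "real r \<in> h ` T" "real s \<in> h ` T"
        using T assms(3)[OF rs(2)] assms(3)[OF rs(3)] by (metis imageI)+
      moreover have "real (Suc r) \<le> real s" using rs(1) by (simp only: of_nat_le_iff Suc_le_eq)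
      then have "real r \<le> real r + 1 / 2" "real r + 1 / 2 \<le> real s" by simp_all
      ultimately have "real r + 1 / 2 \<in> h ` T" by (rule connectedD_interval)
      then have "real r + 1 / 2 \<in> real ` {1..k}"
        using image_mono[OF connectedin_subset_topspace[OF T(1)], of h] assms(2) by (meson subsetD)
      then obtain m where "real r + 1 / 2 = real m" by (rule imageE)
      then have "real (2 * r + 1) = real (2 * m)" by simp
      then have "2 * r + 1 = 2 * m" by (simp only: of_nat_eq_iff)
      then show False by presburger
    qed
  qed auto
  then have "card (?c ` {1..k}) = k" by (simp add: card_image)
  moreover have "?c ` {1..k} \<subseteq> connected_components_of X"
    using assms(3) by (auto simp: connected_component_in_connected_components_of)
  ultimately show ?thesis unfolding at_least_components_def by blast
qed

theorem clsc_poly_correct: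
  assumes "formula_in n \<phi>" "1 \<le> k"
  defines "w \<equiv> etr_word n \<phi>"
  shows "at_least_components k (subtopology (Euclidean_space (12 * Suc (length w)))
     (superlevel_set (12 * Suc (length w)) (clsc_poly k w) 1)) \<longleftrightarrow> (\<exists>x. holds \<phi> x)"
    (is "at_least_components k ?X \<longleftrightarrow> _")
proof -
  have w: "w \<noteq> []" unfolding w_def by (cases \<phi>) (auto simp: etr_word_def)
  let ?d = "12 * Suc (length w)"
  have tX: "topspace ?X = {y \<in> topspace (Euclidean_space ?d). solution k w y}"
    by (auto simp: superlevel_set_def eval_clsc_poly[OF w])
  show ?thesis
  proof
    assume "at_least_components k ?X"
    then have "connected_components_of ?X \<noteq> {}"
      using assms(2) by (auto simp: at_least_components_def)
    then have "topspace ?X \<noteq> {}" by (auto simp: connected_components_of_def)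
    then obtain y where "solution k w y" unfolding tX by blast
    then show "\<exists>x. holds \<phi> x" using solution_imp_holds[OF assms(1)] unfolding w_def by blast
  next
    assume "\<exists>x. holds \<phi> x"
    then obtain y where y: "y \<in> topspace (Euclidean_space ?d)" "solution k w y"
      using holds_imp_solution[OF assms(1) _ assms(2)] unfolding w_def by blast
    let ?z = "12 * length w + fld_index FZ"
    show "at_least_components k ?X"
    proof (rule at_least_components_slices[where h = "\<lambda>y. y ?z" and P = "\<lambda>r. y(?z := real r)"])
      have "continuous_map (powertop_real UNIV) euclideanreal (\<lambda>y. y ?z)"
        by (rule continuous_map_product_projection) simp
      then show "continuous_map ?X euclideanreal (\<lambda>y. y ?z)"
        unfolding Euclidean_space_def by (intro continuous_map_from_subtopology)
      show "(\<lambda>y. y ?z) ` topspace ?X \<subseteq> real ` {1..k}"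
        unfolding tX solution_def solves_boundary by (auto simp: blks_def)
      show "y(?z := real r) \<in> topspace ?X \<and> (y(?z := real r)) ?z = real r" if "r \<in> {1..k}" for r
        using solution_upd[OF y(2) that w] y(1) unfolding tX by (auto simp: topspace_Euclidean_space)
    qed
  qed
qed


section \<open>Writing the polynomial\<close>

definition block_word :: "(blk \<Rightarrow> bool) \<Rightarrow> (blk \<times> fld) list \<Rightarrow> sym list" where
  "block_word F vs = concat (map (\<lambda>e. CommaSym # enc_nat e) (exponents F vs))"

text \<open>The part of the exponent vector for a block depends only on the roles of that block, so
  one pass over the cells can write the vector.\<close>

lemma enc_place:
  "enc_monomial (place N i p m) =
     enc_int (fst m) @ concat (map (\<lambda>j. block_word (blk_at N i p j) (snd m)) [0..<Suc N])"
proof -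
  have "concat (map g (concat (map f js))) = concat (map (\<lambda>j. concat (map g (f j))) js)"
    for g :: "nat \<Rightarrow> sym list" and f :: "nat \<Rightarrow> nat list" and js
    by (induction js) auto
  then show ?thesis by (simp only: enc_monomial_def place_def block_word_def fst_conv snd_conv)
qed

text \<open>A cell of tape 0 holds an input symbol and two marks, for \<open>Cur\<close> and for \<open>Ptr\<close>.\<close>

fun cell :: "sym \<times> bool \<times> bool \<Rightarrow> nat" where
  "cell (s, a, b) = sym_code s + (if a then 14 else 0) + (if b then 28 else 0)"

lemma sym_code_bounds: "0 < sym_code s" "sym_code s < 14"
  by (cases s; simp)+

lemma sym_code_inj: "sym_code s = sym_code t \<Longrightarrow> s = t"
  by (cases s; cases t) simp_all

lemma cell_bounds: "0 < cell c" "cell c < 56"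
  using sym_code_bounds[of "fst c"] by (cases c; simp)+

lemma inj_cell: "inj cell"
proof (rule injI)
  fix c d :: "sym \<times> bool \<times> bool"
  obtain s a b t a' b' where cd: "c = (s, a, b)" "d = (t, a', b')" by (metis surj_pair)
  assume eq: "cell c = cell d"
  have "sym_code s = cell c mod 14" "sym_code t = cell d mod 14"
    unfolding cd by (cases s; cases a; cases b; simp) (cases t; cases a'; cases b'; simp)
  then have "s = t" using eq sym_code_inj by metis
  then show "c = d" using eq cd by (auto split: if_splits)
qed

definition uncell :: "nat \<Rightarrow> sym \<times> bool \<times> bool" where "uncell = inv cell"

lemma uncell_cell [simp]: "uncell (cell c) = c"
  by (simp add: uncell_def inv_f_f[OF inj_cell])

lemma UNIV_sym: "UNIV = {Digit0, Digit1, PlusSym, MinusSym, CommaSym, SlashSym, VarSym,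
    EqSym, GeSym, GtSym, NotSym, AndSym, OrSym}"
proof -
  have "s \<in> {Digit0, Digit1, PlusSym, MinusSym, CommaSym, SlashSym, VarSym,
    EqSym, GeSym, GtSym, NotSym, AndSym, OrSym}" for s by (cases s) simp_all
  then show ?thesis by blast
qed

instance sym :: finite
proof
  show "finite (UNIV :: sym set)" unfolding UNIV_sym by simp
qed

abbreviation "code \<equiv> map sym_code"

text \<open>
  \<open>Move first \<sigma> c v s\<close> moves the marks from stage \<open>\<sigma>\<close> to the next one, where \<open>c\<close> and \<open>v\<close> are the marks
  that the current cell receives; \<open>s\<close> is the symbol under the new \<open>Cur\<close> mark. With \<open>first\<close> it also
  writes the list of variables. \<open>Emit \<sigma> ms c\<close> outputs the first monomial of \<open>ms\<close>, where \<open>c\<close> tells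
  whether the current cell is the \<open>Nxt\<close> block.
\<close>

datatype ctl = Move bool sym bool bool "sym option" | Emit sym lpoly bool | Stop

definition moves_ptr :: "sym \<Rightarrow> bool" where
  "moves_ptr \<sigma> \<longleftrightarrow> \<sigma> \<in> {PlusSym, MinusSym, CommaSym}"

text \<open>A sign sends the pointer to block 0, so the first cell receives that mark; the
  \<open>Cur\<close> mark moves right and never lands there.\<close>

definition start_move :: "sym \<Rightarrow> ctl" where
  "start_move \<sigma> = Move False \<sigma> False (\<sigma> \<in> {PlusSym, MinusSym}) None"

definition cell_blks :: "bool \<Rightarrow> bool \<Rightarrow> bool \<Rightarrow> blk \<Rightarrow> bool" where
  "cell_blks a c v b = (case b of Cur \<Rightarrow> a | Nxt \<Rightarrow> c | Ptr \<Rightarrow> v | Last \<Rightarrow> False)"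

text \<open>The last block lies behind the cells and is treated at the end of a pass; it is never
  \<open>Cur\<close> and carries no pointer mark.\<close>

definition end_blks :: "bool \<Rightarrow> blk \<Rightarrow> bool" where
  "end_blks c b = (case b of Nxt \<Rightarrow> c | Last \<Rightarrow> True | _ \<Rightarrow> False)"

text \<open>The control remembers marks of the cell just left. This delay by one cell shifts marks
  during \<open>Move\<close> and identifies the \<open>Nxt\<close> block during
  \<open>Emit\<close>.\<close>

definition on_cell :: "ctl \<Rightarrow> nat \<Rightarrow> ctl \<times> nat \<times> nat list" where
  "on_cell q x = (case uncell x of (s, a, v) \<Rightarrow> (case q of
     Move first \<sigma> c u t \<Rightarrow>
       (Move first \<sigma> a (\<sigma> = CommaSym \<and> v) (if c then Some s else t),
        cell (s, c, if moves_ptr \<sigma> then u else v),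
        if first then replicate 12 (sym_code VarSym) else [])
   | Emit \<sigma> ms c \<Rightarrow>
       (Emit \<sigma> ms a, cell (s, a, v),
        if ms = [] then [] else code (block_word (cell_blks a c v) (snd (hd ms))))
   | Stop \<Rightarrow> (Stop, cell (s, a, v), [])))"

text \<open>If no letter was found under the new \<open>Cur\<close> mark, the mark has left the word
  and only the threshold \<open>1 / 1\<close> remains to be written. The first pass adds 12
  variables for the block behind the word.\<close>

definition on_end :: "nat \<Rightarrow> ctl \<Rightarrow> ctl \<times> nat list" where
  "on_end k q = (case q of
     Move first \<sigma> c u None \<Rightarrow> (Stop, code [SlashSym, PlusSym, Digit1, SlashSym, PlusSym, Digit1])
   | Move first \<sigma> c u (Some s) \<Rightarrow>
       (Emit s ((if first then boundary k else []) @ neg_squares (eqs s)) False,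
        if first then replicate 12 (sym_code VarSym) else [])
   | Emit \<sigma> [] c \<Rightarrow> (start_move \<sigma>, [])
   | Emit \<sigma> (m # ms) c \<Rightarrow> (Emit \<sigma> ms False, code (block_word (end_blks c) (snd m)))
   | Stop \<Rightarrow> (Stop, []))"

definition before :: "ctl \<Rightarrow> nat list" where
  "before q = (case q of Emit \<sigma> (m # ms) c \<Rightarrow> code (enc_int (fst m)) | _ \<Rightarrow> [])"

text \<open>Every list to be emitted is a suffix of such a table, as later stages omit the boundary
  part in front; hence the control is finite.\<close>

definition full_table :: "nat \<Rightarrow> sym \<Rightarrow> lpoly" where
  "full_table k \<sigma> = boundary k @ neg_squares (eqs \<sigma>)"

definition ctls :: "nat \<Rightarrow> ctl set" where
  "ctls k = insert Stop (range (\<lambda>(f, \<sigma>, c, u, t). Move f \<sigma> c u t) \<union>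
     (\<Union>\<sigma>. (\<lambda>(i, c). Emit \<sigma> (drop i (full_table k \<sigma>)) c) ` ({..length (full_table k \<sigma>)} \<times> UNIV)))"

lemma Emit_in_ctls: "Emit \<sigma> ms c \<in> ctls k \<longleftrightarrow> (\<exists>i. ms = drop i (full_table k \<sigma>))"
proof
  assume "\<exists>i. ms = drop i (full_table k \<sigma>)"
  then obtain i where "ms = drop i (full_table k \<sigma>)" by blast
  then have "ms = drop (min i (length (full_table k \<sigma>))) (full_table k \<sigma>)"
    by (simp add: min_def)
  then have "Emit \<sigma> ms c \<in> (\<lambda>(i, c). Emit \<sigma> (drop i (full_table k \<sigma>)) c) ` ({..length (full_table k \<sigma>)} \<times> UNIV)"
    by (intro image_eqI[of _ _ "(min i (length (full_table k \<sigma>)), c)"]) simp_all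
  then show "Emit \<sigma> ms c \<in> ctls k" unfolding ctls_def by blast
qed (auto simp: ctls_def)

lemma Move_in_ctls [simp]: "Move f \<sigma> c u t \<in> ctls k" "Stop \<in> ctls k"
  by (auto simp: ctls_def intro!: image_eqI[of _ _ "(f, \<sigma>, c, u, t)"])

lemma sym_code_less: "sym_code s < 56"
  by (rule less_trans[OF sym_code_bounds(2)]) simp

lemma code_bounded: "set (code u) \<subseteq> {..<56}"
  using sym_code_less by auto

text \<open>The set-up acts as if a sign in front of the word had just been read, so both marks land
  on the first cell. The bound 56 is \<open>4 * 14\<close>: two marks on letter codes below
  14.\<close>

interpretation red: sweeper on_cell "on_end k" before "ctls k"
  "Move True PlusSym True True None" Stop 56 for k
proof
  show "finite (ctls k)" unfolding ctls_def by simp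
  show "Move True PlusSym True True None \<in> ctls k" "Stop \<in> ctls k"
    "Move True PlusSym True True None \<noteq> Stop" "0 < (56 :: nat)" by simp_all
  note bnd = code_bounded[of "[VarSym]"] code_bounded
  fix q q' c c' v
  show "set (before q) \<subseteq> {..<56}"
    unfolding before_def using bnd by (cases q) (auto split: list.splits)
  assume q: "q \<in> ctls k"
  show "q' \<in> ctls k \<and> 0 < c' \<and> c' < 56 \<and> set v \<subseteq> {..<56}" if "on_cell q c = (q', c', v)"
  proof -
    obtain s a u where un: "uncell c = (s, a, u)" by (metis surj_pair)
    show ?thesis
      using that q cell_bounds bnd
      by (cases q) (auto simp: on_cell_def un Emit_in_ctls sym_code_less simp del: cell.simps split: if_splits)
  qed
  show "q' \<in> ctls k \<and> set v \<subseteq> {..<56}" if "on_end k q = (q', v)"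
  proof (cases q)
    case (Move f \<sigma> c u t)
    have "neg_squares (eqs s) = drop (length (boundary k)) (full_table k s)" for s
      by (simp add: full_table_def)
    moreover have "boundary k @ neg_squares (eqs s) = drop 0 (full_table k s)" for s
      by (simp add: full_table_def)
    moreover have "\<exists>i. full_table k s = drop i (full_table k s)" for s
      by (rule exI[of _ 0]) simp
    ultimately show ?thesis
      using that bnd unfolding on_end_def Move
      by (cases t; cases f) (auto simp: Emit_in_ctls simp del: list.map)
  next
    case (Emit \<sigma> ms c)
    show ?thesis
    proof (cases ms)
      case Nil
      then show ?thesis using that by (auto simp: on_end_def Emit start_move_def)
    next
      case (Cons m ms')
      obtain i where "ms = drop i (full_table k \<sigma>)" using q Emit by (auto simp: Emit_in_ctls)
      then have "ms' = drop (Suc i) (full_table k \<sigma>)" using Cons by (metis drop_Suc list.sel(3) tl_drop)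
      then show ?thesis using that Cons by (auto simp: on_end_def Emit Emit_in_ctls sym_code_less)
    qed
  next
    case Stop
    then show ?thesis using that by (auto simp: on_end_def)
  qed
qed

section \<open>Passes over the marked word\<close>

definition marked_cell :: "sym list \<Rightarrow> nat \<Rightarrow> nat \<Rightarrow> nat" where
  "marked_cell w i j = cell (w ! j, j = i, j = ptr_at w i)"

definition marked :: "sym list \<Rightarrow> nat \<Rightarrow> nat list" where
  "marked w i = map (marked_cell w i) [0..<length w]"

text \<open>The flag \<open>j = Suc i\<close> tells that the cell just left is \<open>Cur\<close>;
  at the end of the pass it tells whether the last block is \<open>Nxt\<close>.\<close>

lemma mealy_Emit:
  assumes "j \<le> length w" "ms \<noteq> []"
  shows "red.mealy (Emit \<sigma> ms (j = Suc i)) (map (marked_cell w i) [j..<length w]) =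
    (Emit \<sigma> ms (length w = Suc i), map (marked_cell w i) [j..<length w],
     code (concat (map (\<lambda>j. block_word (blk_at (length w) i (ptr_at w i) j) (snd (hd ms))) [j..<length w])))"
  using assms(1)
proof (induction rule: inc_induct)
  case (step j)
  have "cell_blks (j = i) (j = Suc i) (j = ptr_at w i) = blk_at (length w) i (ptr_at w i) j"
    using step(2) by (auto simp: cell_blks_def blk_at_def fun_eq_iff split: blk.splits)
  then have "on_cell (Emit \<sigma> ms (j = Suc i)) (marked_cell w i j) =
     (Emit \<sigma> ms (Suc j = Suc i), marked_cell w i j,
      code (block_word (blk_at (length w) i (ptr_at w i) j) (snd (hd ms))))"
    using assms(2) by (simp add: on_cell_def marked_cell_def del: cell.simps)
  then show ?case using step by (simp add: upt_conv_Cons)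
qed simp

lemma sweep_Emit:
  assumes "i < length w"
  shows "red.sweep k (Emit \<sigma> (m # ms) False, marked w i, v) =
    (Emit \<sigma> ms False, marked w i, v @ code (enc_monomial (place (length w) i (ptr_at w i) m)))"
proof -
  let ?N = "length w"
  have e: "end_blks (?N = Suc i) = blk_at ?N i (ptr_at w i) ?N"
    using assms by (auto simp: end_blks_def blk_at_def fun_eq_iff split: blk.splits)
  have "(0 = Suc i) = False" by simp
  then show ?thesis
    using mealy_Emit[of 0 w "m # ms" \<sigma> i]
    by (simp add: red.sweep_def marked_def on_end_def e before_def enc_place)
qed

lemma sweeps_Emit:
  assumes "i < length w"
  shows "(red.sweep k ^^ length ms) (Emit \<sigma> ms False, marked w i, v) =
    (Emit \<sigma> [] False, marked w i, v @ code (enc_mpoly (map (place (length w) i (ptr_at w i)) ms)))"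
proof (induction ms arbitrary: v)
  case (Cons m ms)
  show ?case
    using Cons by (simp add: funpow_Suc_right sweep_Emit[OF assms] enc_mpoly_def del: funpow.simps)
qed (simp add: enc_mpoly_def)

text \<open>An exhausted list is noticed only at the right end, which costs one idle pass per
  stage.\<close>

lemma mealy_Emit_Nil:
  "j \<le> length w \<Longrightarrow> \<exists>c'. red.mealy (Emit \<sigma> [] c) (map (marked_cell w i) [j..<length w]) =
    (Emit \<sigma> [] c', map (marked_cell w i) [j..<length w], [])"
proof (induction arbitrary: c rule: inc_induct)
  case (step j)
  have "on_cell (Emit \<sigma> [] c) (marked_cell w i j) = (Emit \<sigma> [] (j = i), marked_cell w i j, [])"
    by (simp add: on_cell_def marked_cell_def del: cell.simps)
  moreover obtain c' where "red.mealy (Emit \<sigma> [] (j = i)) (map (marked_cell w i) [Suc j..<length w]) =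
    (Emit \<sigma> [] c', map (marked_cell w i) [Suc j..<length w], [])"
    using step(3) by blast
  ultimately show ?case using step(2) by (auto simp add: upt_conv_Cons)
qed simp

lemma sweep_Emit_Nil: "red.sweep k (Emit \<sigma> [] False, marked w i, v) = (start_move \<sigma>, marked w i, v)"
proof -
  obtain c' where "red.mealy (Emit \<sigma> [] False) (marked w i) = (Emit \<sigma> [] c', marked w i, [])"
    using mealy_Emit_Nil[of 0 w \<sigma> False i] by (auto simp: marked_def)
  then show ?thesis by (simp add: red.sweep_def on_end_def before_def)
qed

lemma ptr_at_Suc: "i < length w \<Longrightarrow> ptr_at w (Suc i) = next_ptr (w ! i) (ptr_at w i)"
  by (simp add: ptr_at_def take_Suc_conv_app_nth)

text \<open>On arrival at cell \<open>j\<close> the control holds the marks due there and, once past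
  cell \<open>Suc i\<close>, the letter of that cell. A comma delays the pointer mark by one cell; a
  sign places it on cell 0.\<close>

lemma mealy_Move:
  assumes "j \<le> length w" "i < length w"
  shows "red.mealy (Move False (w ! i) (j = Suc i)
       (if w ! i = CommaSym then j = Suc (ptr_at w i) else w ! i \<in> {PlusSym, MinusSym} \<and> j = 0)
       (if Suc i < j then Some (w ! Suc i) else None)) (map (marked_cell w i) [j..<length w]) =
    (Move False (w ! i) (length w = Suc i)
       (if w ! i = CommaSym then length w = Suc (ptr_at w i) else w ! i \<in> {PlusSym, MinusSym} \<and> length w = 0)
       (if Suc i < length w then Some (w ! Suc i) else None),
     map (marked_cell w (Suc i)) [j..<length w], [])"
  using assms(1)
proof (induction rule: inc_induct)
  case (step j)
  have "on_cell (Move False (w ! i) (j = Suc i)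
       (if w ! i = CommaSym then j = Suc (ptr_at w i) else w ! i \<in> {PlusSym, MinusSym} \<and> j = 0)
       (if Suc i < j then Some (w ! Suc i) else None)) (marked_cell w i j) =
     (Move False (w ! i) (Suc j = Suc i)
       (if w ! i = CommaSym then Suc j = Suc (ptr_at w i) else w ! i \<in> {PlusSym, MinusSym} \<and> Suc j = 0)
       (if Suc i < Suc j then Some (w ! Suc i) else None), marked_cell w (Suc i) j, [])"
    using ptr_at_Suc[OF assms(2)]
    by (cases "w ! i") (auto simp add: on_cell_def marked_cell_def moves_ptr_def simp del: cell.simps)
  then show ?case using step by (simp add: upt_conv_Cons del: if_split)
qed simp

definition tail :: "sym list" where
  "tail = [SlashSym, PlusSym, Digit1, SlashSym, PlusSym, Digit1]"

lemma sweep_Move: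
  assumes "i < length w"
  shows "red.sweep k (start_move (w ! i), marked w i, v) =
    (if Suc i < length w then (Emit (w ! Suc i) (stage_poly k w (Suc i)) False, marked w (Suc i), v)
     else (Stop, marked w (Suc i), v @ code tail))"
proof -
  have "start_move (w ! i) = Move False (w ! i) (0 = Suc i)
       (if w ! i = CommaSym then 0 = Suc (ptr_at w i) else w ! i \<in> {PlusSym, MinusSym} \<and> (0 :: nat) = 0)
       (if Suc i < 0 then Some (w ! Suc i) else None)"
    by (auto simp: start_move_def)
  then show ?thesis
    using mealy_Move[of 0 w i] assms
    by (auto simp: red.sweep_def marked_def on_end_def before_def stage_poly_def tail_def start_move_def)
qed

lemma mealy_setup:
  assumes "j \<le> length w"
  shows "red.mealy (Move True PlusSym (j = 0) (j = 0) (if 0 < j then Some (w ! 0) else None))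
       (map sym_code (drop j w)) =
    (Move True PlusSym (length w = 0) (length w = 0) (if 0 < length w then Some (w ! 0) else None),
     map (marked_cell w 0) [j..<length w], code (replicate (12 * (length w - j)) VarSym))"
  using assms
proof (induction rule: inc_induct)
  case (step j)
  have "on_cell (Move True PlusSym (j = 0) (j = 0) (if 0 < j then Some (w ! 0) else None)) (cell (w ! j, False, False)) =
     (Move True PlusSym (Suc j = 0) (Suc j = 0) (if 0 < Suc j then Some (w ! 0) else None), marked_cell w 0 j,
      replicate 12 (sym_code VarSym))"
    by (auto simp add: on_cell_def marked_cell_def moves_ptr_def ptr_at_def simp del: cell.simps)
  moreover have "12 * (length w - j) = 12 + 12 * (length w - Suc j)" using step(2) by simp
  \<comment> \<open>A cell without marks has the code of its letter, so the raw input already is a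
    word of unmarked cells.\<close>
  moreover have "map sym_code (drop j w) = cell (w ! j, False, False) # map sym_code (drop (Suc j) w)"
    using step(2) by (simp add: Cons_nth_drop_Suc[symmetric])
  ultimately show ?case using step
    by (simp only: red.mealy.simps upt_conv_Cons list.map) (simp add: replicate_add)
qed simp

lemma sweep_setup:
  assumes "w \<noteq> []"
  shows "red.sweep k (Move True PlusSym True True None, code w, []) =
    (Emit (w ! 0) (stage_poly k w 0) False, marked w 0, code (replicate (12 * Suc (length w)) VarSym))"
proof -
  have "12 * Suc (length w) = 12 * length w + 12" by simp
  then show ?thesis
    using mealy_setup[of 0 w] assms
    by (simp add: red.sweep_def marked_def on_end_def before_def stage_poly_def flip: replicate_add)
qed

definition max_table :: "nat \<Rightarrow> nat" where
  "max_table k = (\<Sum>\<sigma>\<in>UNIV. length (full_table k \<sigma>))"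

lemma length_stage_poly: "length (stage_poly k w i) \<le> max_table k"
proof -
  have "length (full_table k (w ! i)) \<le> max_table k"
    unfolding max_table_def by (rule member_le_sum) simp_all
  then show ?thesis by (auto simp: stage_poly_def full_table_def)
qed

text \<open>A stage takes one pass per monomial, an idle pass and a pass that moves the
  marks.\<close>

lemma sweeps_stages:
  assumes "i < length w"
  shows "\<exists>n \<le> (length w - i) * (max_table k + 2). \<exists>u.
    (red.sweep k ^^ n) (Emit (w ! i) (stage_poly k w i) False, marked w i, v) =
      (Stop, u, v @ code (enc_mpoly (concat (map (\<lambda>i. map (place (length w) i (ptr_at w i)) (stage_poly k w i))
          [i..<length w])) @ tail))"
  using assms
proof (induction "length w - Suc i" arbitrary: i v)
  case 0
  then have i: "Suc i = length w" by simp
  let ?L = "length (stage_poly k w i)"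
  let ?e = "code (enc_mpoly (map (place (length w) i (ptr_at w i)) (stage_poly k w i)))"
  have "(red.sweep k ^^ (Suc (Suc ?L))) (Emit (w ! i) (stage_poly k w i) False, marked w i, v) =
      (Stop, marked w (Suc i), v @ ?e @ code tail)"
    using 0 i by (simp add: sweeps_Emit sweep_Emit_Nil sweep_Move)
  moreover have "[i..<length w] = [i]" using i by (simp add: upt_rec)
  moreover have "Suc (Suc ?L) \<le> (length w - i) * (max_table k + 2)"
    using i length_stage_poly[of k w i] by (simp flip: i)
  ultimately show ?case by (intro exI[of _ "Suc (Suc ?L)"] conjI exI[of _ "marked w (Suc i)"]) simp_all
next
  case (Suc d)
  then have i: "Suc i < length w" by simp
  let ?L = "length (stage_poly k w i)"
  let ?e = "code (enc_mpoly (map (place (length w) i (ptr_at w i)) (stage_poly k w i)))"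
  have a: "(red.sweep k ^^ (Suc (Suc ?L))) (Emit (w ! i) (stage_poly k w i) False, marked w i, v) =
      (Emit (w ! Suc i) (stage_poly k w (Suc i)) False, marked w (Suc i), v @ ?e)"
    using Suc.prems i by (simp add: sweeps_Emit sweep_Emit_Nil sweep_Move)
  have "d = length w - Suc (Suc i)" using Suc by simp
  from Suc.hyps(1)[OF this i, of "v @ ?e"] obtain n u where n: "n \<le> (length w - Suc i) * (max_table k + 2)"
    "(red.sweep k ^^ n) (Emit (w ! Suc i) (stage_poly k w (Suc i)) False, marked w (Suc i), v @ ?e) =
      (Stop, u, (v @ ?e) @ code (enc_mpoly (concat (map (\<lambda>i. map (place (length w) i (ptr_at w i)) (stage_poly k w i))
          [Suc i..<length w])) @ tail))" by blast
  have "(red.sweep k ^^ (n + Suc (Suc ?L))) (Emit (w ! i) (stage_poly k w i) False, marked w i, v) =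
      (Stop, u, v @ code (enc_mpoly (concat (map (\<lambda>i. map (place (length w) i (ptr_at w i)) (stage_poly k w i))
          [i..<length w])) @ tail))"
    unfolding funpow_add comp_def a n(2) using Suc.prems by (simp add: upt_conv_Cons enc_mpoly_def)
  moreover have "length w - i = Suc (length w - Suc i)" using Suc.prems by simp
  then have "n + Suc (Suc ?L) \<le> (length w - i) * (max_table k + 2)"
    using n(1) length_stage_poly[of k w i] by simp
  ultimately show ?case by blast
qed

text \<open>After one set-up pass there are linearly many passes of linear cost, so the running time
  is quadratic for fixed \<open>k\<close>.\<close>

lemma reduction_outputs:
  assumes "w \<noteq> []"
  shows "tm_outputs_within (red.machine k) (code w)
     (code (replicate (12 * Suc (length w)) VarSym @ enc_mpoly (clsc_poly k w) @ tail))
     (Suc (length w * (max_table k + 2)) * ((red.max_out k + 4) * (length w + 3)))"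
proof -
  obtain n u where n: "n \<le> length w * (max_table k + 2)"
    "(red.sweep k ^^ n) (Emit (w ! 0) (stage_poly k w 0) False, marked w 0,
        code (replicate (12 * Suc (length w)) VarSym)) =
      (Stop, u, code (replicate (12 * Suc (length w)) VarSym) @ code (enc_mpoly (clsc_poly k w) @ tail))"
    using sweeps_stages[of 0 w k] assms unfolding clsc_poly_def by fastforce
  have "(red.sweep k ^^ Suc n) (Move True PlusSym True True None, code w, []) =
      (Stop, u, code (replicate (12 * Suc (length w)) VarSym @ enc_mpoly (clsc_poly k w) @ tail))"
    unfolding funpow_Suc_right comp_def sweep_setup[OF assms] n(2) by simp
  moreover have "set (code w) \<subseteq> {0<..<56}" using sym_code_bounds(1) sym_code_less by auto
  moreover have "code w \<noteq> []" using assms by simp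
  moreover have "Suc n \<le> Suc (length w * (max_table k + 2))" using n(1) by simp
  ultimately have "tm_outputs_within (red.machine k) (code w)
     (code (replicate (12 * Suc (length w)) VarSym @ enc_mpoly (clsc_poly k w) @ tail))
     (Suc (length w * (max_table k + 2)) * ((red.max_out k + 4) * (length (code w) + 3)))"
    by (rule red.machine_outputs)
  then show ?thesis by (simp only: length_map)
qed

theorem theorem5p1:
  fixes k :: nat
  assumes "k \<ge> 2"
  shows "ER_hard (CLSC k)"
  unfolding ER_hard_def poly_time_reducible_def
proof (intro exI conjI ballI)
  let ?f = "\<lambda>(n, \<phi>). (12 * Suc (length (etr_word n \<phi>)), clsc_poly k (etr_word n \<phi>), 1 :: int, 1 :: int)"
  fix x assume x: "x \<in> instances ETR"
  then obtain n \<phi> where nf: "x = (n, \<phi>)" "formula_in n \<phi>" by (auto simp: ETR_def)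
  show "?f x \<in> instances (CLSC k)"
    using mpoly_in_clsc_poly by (simp add: nf CLSC_def)
  show "x \<in> yes ETR \<longleftrightarrow> ?f x \<in> yes (CLSC k)"
    using clsc_poly_correct[OF nf(2), of k] mpoly_in_clsc_poly assms nf
    by (simp add: CLSC_def ETR_def)
next
  let ?f = "\<lambda>(n, \<phi>). (12 * Suc (length (etr_word n \<phi>)), clsc_poly k (etr_word n \<phi>), 1 :: int, 1 :: int)"
  have ne: "etr_word n \<phi> \<noteq> []" for n \<phi> by (cases \<phi>) (auto simp: etr_word_def)
  let ?c = "max_table k + 2" and ?d = "red.max_out k + 4"
  \<comment> \<open>The factors are \<open>1 + ?c * m\<close>, for the number of passes, and
    \<open>?d * (m + 3)\<close>, for the cost of each.\<close>
  let ?p = "[:1, ?c:] * [:3 * ?d, ?d:] :: nat poly"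
  have enc_one: "enc_int 1 = [PlusSym, Digit1]"
    by (simp add: enc_int_def enc_nat.simps)
  have "tm_outputs_within (red.machine k) (encode ETR x) (encode (CLSC k) (?f x)) (poly ?p (length (encode ETR x)))"
    if "x \<in> instances ETR" for x
  proof -
    obtain n \<phi> where x: "x = (n, \<phi>)" by (cases x)
    have "encode ETR x = code (etr_word n \<phi>)" by (simp add: x ETR_def etr_word_def)
    moreover have "encode (CLSC k) (?f x) =
        code (replicate (12 * Suc (length (etr_word n \<phi>))) VarSym @ enc_mpoly (clsc_poly k (etr_word n \<phi>)) @ tail)"
      by (simp add: x CLSC_def enc_one tail_def)
    moreover have "poly ?p m = Suc (m * ?c) * (?d * (m + 3))" for m
      by (simp add: algebra_simps)
    ultimately show ?thesis using reduction_outputs[OF ne[of n \<phi>], of k] by simp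
  qed
  moreover have "set (encode ETR x) \<subseteq> {0<..<alphabet (red.machine k)}" for x
    using sym_code_bounds(1) sym_code_less by (auto simp: ETR_def red.machine_def)
  ultimately show "poly_time_computable (encode ETR) (encode (CLSC k)) (instances ETR) ?f"
    unfolding poly_time_computable_def using red.wf_machine by blast
qed

end
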